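(* Let $\{(N_k,B_k)\}_{k=1}^\infty$ be a sequence of admissible pairs in $\mathbb{R}$ and let $\mu$ be the infinite convolution of $\{(N_k,B_k)\}_{k=1}^\infty$ (assumed to exist). Let $\mathcal{E}$ be the set of all positive integers $t$ such that $t$ is an admissible eigenvalue of $(N_k,B_k)$ for all $k\in\mathbb{N}_+$ and $\mu$ is a $t$-equi-positive measure. (1) If $\mathcal{E}\ne\emptyset$, then $\mu$ is a spectral measure. (2) If there exists $t\in\mathcal{E}$ with $t>1$, then there exist uncountably many subsets $\Lambda\subset\mathbb{Z}$ such that $t\Lambda$ is a spectrum of $\mu$ for every $t\in\mathcal{E}$. Moreover, each element of $\mathcal{E}$ is a spectral eigenvalue of $\mu$.
   Context: For a nonempty finite $D\subset\mathbb{R}$, $\delta_D=\frac{1}{\#D}\sum_{a\in D}\delta_a$. $\widehat{\mu}(\xi)=\int_{\mathbb{R}}e^{-2\pi i\xi x}\,d\mu(x)$. Admissible pair / Hadamard triple: let $N\ge2$ be an integer and $B\subset\mathbb{Z}$ finite with $\#B\ge2$. If $L\subset\mathbb{Z}$ is such that the matrix $\left[\frac{1}{\sqrt{\#B}}e^{-2\pi i bl/N}\right]_{b\in B,\,l\in L}$ is unitary (so $\#L=\#B$), then $(N,B,L)$ is a Hadamard triple; $(N,B)$ is an admissible pair if such an $L$ exists. A number $t\in\mathbb{R}$ is an admissible eigenvalue of an admissible pair $(N,B)$ if, whenever $(N,B,L)$ is a Hadamard triple for some $L\subset\mathbb{Z}$, $(N,B,tL)$ is also a Hadamard triple. Infinite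 convolution: $\mu=\delta_{N_1^{-1}B_1}*\delta_{(N_1N_2)^{-1}B_2}*\cdots$ is the weak limit (when it exists as a Borel probability measure) of $\delta_{N_1^{-1}B_1}*\cdots*\delta_{(N_1\cdots N_k)^{-1}B_k}$. Put $\nu_{>k}=\delta_{N_{k+1}^{-1}B_{k+1}}*\delta_{(N_{k+1}N_{k+2})^{-1}B_{k+2}}*\cdots$. $t$-equi-positivity: for a positive integer $t$, a set $\Phi$ of Borel probability measures on $\mathbb{R}$ is a $t$-equi-positive family if there exist $\epsilon_0>0$ and $\delta_0>0$ such that for all $x\in[0,t)$ and $\eta\in\Phi$ there is $k_{x,\eta}\in\mathbb{Z}$ with $|\widehat{\eta}(x+y+tk_{x,\eta})|\ge\epsilon_0$ for all $|y|<\delta_0$, where $k_{x,\eta}=0$ for $x=0$. The infinite convolution $\mu$ is a $t$-equi-positive measure if some subsequence $\{\nu_{>n_j}\}_{j=1}^\infty$ of $\{\nu_{>k}\}$ forms a $t$-equi-positive family. Spectrality: a Borel probability measure $\mu$ on $\mathbb{R}$ is a spectral measure if there is a countable $\Lambda\subset\mathbb{R}$ (called a spectrum of $\mu$) such that $\{e^{-2\pi i\lambda x}:\lambda\in\Lambda\}$ is an orthonormal basis of $L^2(\mu)$. A real $t\ne0$ is a spectral eigenvalue of $\mu$ if there is $\Lambda\subset\mathbb{R}$ such that both $\Lambda$ and $t\Lambda$ are spectra of $\mu$. *)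

theory Defs
  imports "HOL-Probability.Probability"
begin

definition unitary_matrix_on :: "'a set \<Rightarrow> 'b set \<Rightarrow> ('a \<Rightarrow> 'b \<Rightarrow> complex) \<Rightarrow> bool" where
  "unitary_matrix_on I J U \<longleftrightarrow>
     finite I \<and> finite J \<and> card I = card J \<and>
     (\<forall>i\<in>I. \<forall>i'\<in>I. (\<Sum>j\<in>J. U i j * cnj (U i' j)) = of_bool (i = i')) \<and>
     (\<forall>j\<in>J. \<forall>j'\<in>J. (\<Sum>i\<in>I. cnj (U i j) * U i j') = of_bool (j = j'))"

text \<open>Sets of integers are subsets of \<open>\<int> :: real set\<close>, so that \<open>t L\<close> makes sense for real
  \<open>t\<close>; in particular \<open>t L \<subseteq> \<int>\<close> is part of the claim that \<open>(N, B, t L)\<close> is a Hadamard triple.\<close>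

definition hadamard_triple :: "nat \<Rightarrow> real set \<Rightarrow> real set \<Rightarrow> bool" where
  "hadamard_triple N B L \<longleftrightarrow>
     2 \<le> N \<and> B \<subseteq> \<int> \<and> finite B \<and> 2 \<le> card B \<and> L \<subseteq> \<int> \<and>
     unitary_matrix_on B L
       (\<lambda>b l. of_real (1 / sqrt (real (card B))) *
              exp (- 2 * of_real pi * \<i> * of_real (b * l / real N)))"

definition admissible_pair :: "nat \<Rightarrow> real set \<Rightarrow> bool" where
  "admissible_pair N B \<longleftrightarrow> (\<exists>L. hadamard_triple N B L)"

definition admissible_eigenvalue :: "nat \<Rightarrow> real set \<Rightarrow> real \<Rightarrow> bool" where
  "admissible_eigenvalue N B t \<longleftrightarrow>
     admissible_pair N B \<and>
     (\<forall>L. hadamard_triple N B L \<longrightarrow> hadamard_triple N B ((*) t ` L))"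

text \<open>The measure \<open>\<delta>\<^sub>D\<close> for finite nonempty \<open>D\<close>.\<close>

definition uniform_discrete :: "real set \<Rightarrow> real measure" where
  "uniform_discrete D = distr (measure_pmf (pmf_of_set D)) borel (\<lambda>x. x)"

text \<open>Sequences are indexed from 0: \<open>(N k, B k)\<close> is the pair \<open>(N\<^bsub>k+1\<^esub>, B\<^bsub>k+1\<^esub>)\<close> of the usual
  numbering from 1. Thus \<open>finite_convolution N B n\<close> has the \<open>n\<close> factors
  \<open>uniform_discrete ((N 0 \<cdots> N k)\<^sup>-\<^sup>1 B k)\<close>, \<open>k < n\<close>; it is the point mass at 0 for \<open>n = 0\<close>.\<close>

primrec finite_convolution :: "(nat \<Rightarrow> nat) \<Rightarrow> (nat \<Rightarrow> real set) \<Rightarrow> nat \<Rightarrow> real measure" where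
  "finite_convolution N B 0 = return borel 0"
| "finite_convolution N B (Suc n) =
     (finite_convolution N B n \<star> uniform_discrete ((\<lambda>b. b / real (\<Prod>i\<le>n. N i)) ` B n))"

definition is_infinite_convolution ::
  "(nat \<Rightarrow> nat) \<Rightarrow> (nat \<Rightarrow> real set) \<Rightarrow> real measure \<Rightarrow> bool" where
  "is_infinite_convolution N B \<mu> \<longleftrightarrow>
     real_distribution \<mu> \<and> weak_conv_m (finite_convolution N B) \<mu>"

text \<open>The relation \<open>\<nu> = \<nu>\<^bsub>>k\<^esub>\<close>: the infinite convolution of the sequence without its first
  \<open>k\<close> pairs.\<close>

definition is_tail_convolution ::
  "(nat \<Rightarrow> nat) \<Rightarrow> (nat \<Rightarrow> real set) \<Rightarrow> nat \<Rightarrow> real measure \<Rightarrow> bool" where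
  "is_tail_convolution N B k \<nu> \<longleftrightarrow>
     is_infinite_convolution (\<lambda>i. N (k + i)) (\<lambda>i. B (k + i)) \<nu>"

definition fourier_transform :: "real measure \<Rightarrow> real \<Rightarrow> complex" where
  "fourier_transform \<mu> \<xi> = (CLINT x|\<mu>. exp (- 2 * of_real pi * \<i> * of_real (\<xi> * x)))"

definition equi_positive_family :: "nat \<Rightarrow> real measure set \<Rightarrow> bool" where
  "equi_positive_family t \<Phi> \<longleftrightarrow>
     0 < t \<and> (\<forall>\<eta>\<in>\<Phi>. real_distribution \<eta>) \<and>
     (\<exists>\<epsilon>>0. \<exists>\<delta>>0. \<forall>x\<in>{0..<real t}. \<forall>\<eta>\<in>\<Phi>. \<exists>k::int.
        (x = 0 \<longrightarrow> k = 0) \<and>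
        (\<forall>y. \<bar>y\<bar> < \<delta> \<longrightarrow>
           \<epsilon> \<le> norm (fourier_transform \<eta> (x + y + real t * real_of_int k))))"

text \<open>The notion depends on the sequence of pairs, not only on the measure \<open>\<mu>\<close>.\<close>

definition equi_positive_convolution ::
  "nat \<Rightarrow> (nat \<Rightarrow> nat) \<Rightarrow> (nat \<Rightarrow> real set) \<Rightarrow> real measure \<Rightarrow> bool" where
  "equi_positive_convolution t N B \<mu> \<longleftrightarrow>
     is_infinite_convolution N B \<mu> \<and>
     (\<exists>(n :: nat \<Rightarrow> nat) (\<nu> :: nat \<Rightarrow> real measure).
        strict_mono n \<and> (\<forall>j. is_tail_convolution N B (n j) (\<nu> j)) \<and>
        equi_positive_family t (range \<nu>))"

definition L2_space :: "'a measure \<Rightarrow> ('a \<Rightarrow> complex) set" where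
  "L2_space M = {f \<in> borel_measurable M. integrable M (\<lambda>x. (norm (f x))\<^sup>2)}"

definition L2_inner :: "'a measure \<Rightarrow> ('a \<Rightarrow> complex) \<Rightarrow> ('a \<Rightarrow> complex) \<Rightarrow> complex" where
  "L2_inner M f g = (CLINT x|M. f x * cnj (g x))"

definition L2_dist :: "'a measure \<Rightarrow> ('a \<Rightarrow> complex) \<Rightarrow> ('a \<Rightarrow> complex) \<Rightarrow> real" where
  "L2_dist M f g = sqrt (LINT x|M. (norm (f x - g x))\<^sup>2)"

text \<open>An orthonormal family whose linear span is dense. Functions stand for their classes modulo
  null sets; orthonormality is that of the family indexed by \<open>I\<close>, so distinct indices give
  distinct (orthogonal) classes.\<close>

definition L2_orthonormal_basis :: "'a measure \<Rightarrow> 'i set \<Rightarrow> ('i \<Rightarrow> 'a \<Rightarrow> complex) \<Rightarrow> bool" where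
  "L2_orthonormal_basis M I e \<longleftrightarrow>
     (\<forall>i\<in>I. e i \<in> L2_space M) \<and>
     (\<forall>i\<in>I. \<forall>j\<in>I. L2_inner M (e i) (e j) = of_bool (i = j)) \<and>
     (\<forall>f\<in>L2_space M. \<forall>\<epsilon>>0. \<exists>F c. finite F \<and> F \<subseteq> I \<and>
        L2_dist M f (\<lambda>x. \<Sum>i\<in>F. c i * e i x) < \<epsilon>)"

definition is_spectrum :: "real measure \<Rightarrow> real set \<Rightarrow> bool" where
  "is_spectrum \<mu> \<Lambda> \<longleftrightarrow>
     real_distribution \<mu> \<and> countable \<Lambda> \<and>
     L2_orthonormal_basis \<mu> \<Lambda> (\<lambda>l x. exp (- 2 * of_real pi * \<i> * of_real (l * x)))"

definition spectral_measure :: "real measure \<Rightarrow> bool" where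
  "spectral_measure \<mu> \<longleftrightarrow> (\<exists>\<Lambda>. is_spectrum \<mu> \<Lambda>)"

definition spectral_eigenvalue :: "real measure \<Rightarrow> real \<Rightarrow> bool" where
  "spectral_eigenvalue \<mu> t \<longleftrightarrow>
     t \<noteq> 0 \<and> (\<exists>\<Lambda>. is_spectrum \<mu> \<Lambda> \<and> is_spectrum \<mu> ((*) t ` \<Lambda>))"

end

theory Submission
  imports Defs "HOL-Real_Asymp.Real_Asymp"
begin

text \<open>Let \<open>M\<^bsub>n\<^esub>\<close> be the Fourier transform of the convolution of the first \<open>n\<close> factors, \<open>P\<^bsub>n\<^esub>\<close> the product
  of the first \<open>n\<close> bases, and \<open>\<nu>\<^bsub>>n\<^esub>\<close> the tail, so that the transform of \<open>\<mu>\<close> at \<open>\<xi>\<close> is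
  \<open>M\<^bsub>n\<^esub>(\<xi>)\<close> times that of \<open>\<nu>\<^bsub>>n\<^esub>\<close> at \<open>\<xi> / P\<^bsub>n\<^esub>\<close>. Call a finite set \<open>\<Lambda>\<close> of integers a common spectrum at
  level \<open>n\<close> if the sum over \<open>\<lambda> \<in> \<Lambda>\<close> of \<open>|M\<^bsub>n\<^esub>(\<xi> + t \<lambda>)|\<^sup>2\<close> is 1 for all \<open>\<xi>\<close> and all \<open>t \<in> E\<close>. The set
  \<open>\<Lambda> + P\<^bsub>n\<^esub> L\<close>, with \<open>0 \<in> L\<close> coming from a Hadamard triple, is then a common spectrum at the next level, and
  points may be moved freely by multiples of \<open>P\<^bsub>n\<^esub>\<close>. Equi-positivity for \<open>t\<close> provides levels and moves,
  fixing the old points, after which the transform of \<open>\<nu>\<^bsub>>n\<^esub>\<close> is bounded away from 0 at all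
  \<open>t \<lambda> / P\<^bsub>n\<^esub>\<close>. If every \<open>t \<in> E\<close> is served infinitely often, domination passes the identity to the
  limit, which makes \<open>t \<Lambda>\<close> a spectrum of \<open>\<mu>\<close> for the union \<open>\<Lambda>\<close> of the levels. Since \<open>1 \<in> E\<close> as soon as
  \<open>E\<close> is nonempty, \<open>\<Lambda>\<close> itself is a spectrum. If \<open>E\<close> contains some \<open>s > 1\<close>, then at every stage a new
  point can be placed in two incompatible ways, so that the construction gives an injection of the
  binary sequences into the common spectra.\<close>

section \<open>Density of the characters in \<open>L\<^sup>2\<close>\<close>

definition wave :: "real \<Rightarrow> real \<Rightarrow> complex" where
  "wave a x = exp (- 2 * of_real pi * \<i> * of_real (a * x))"

lemma wave_eq_cis: "wave a x = cis (- 2 * pi * (a * x))"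
  by (simp add: wave_def cis_conv_exp algebra_simps)

lemma norm_wave [simp]: "norm (wave a x) = 1"
  by (simp add: wave_eq_cis)

lemma wave_0_left [simp]: "wave 0 x = 1"
  by (simp add: wave_def)

lemma wave_0_right [simp]: "wave a 0 = 1"
  by (simp add: wave_def)

lemma wave_add_left: "wave (a + b) x = wave a x * wave b x"
  by (simp add: wave_eq_cis cis_mult algebra_simps)

lemma wave_add_right: "wave a (x + y) = wave a x * wave a y"
  by (simp add: wave_eq_cis cis_mult algebra_simps)

lemma cnj_wave [simp]: "cnj (wave a x) = wave (- a) x"
  by (simp add: wave_eq_cis cis_cnj)

lemma wave_minus_left: "wave (a - b) x = wave a x * cnj (wave b x)"
  using wave_add_left[of a "- b" x] by simp

lemma wave_Ints:
  assumes "a * x \<in> \<int>"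
  shows "wave a x = 1"
proof -
  obtain k where "a * x = of_int k"
    using assms by (auto elim: Ints_cases)
  then have "wave a x = cis (2 * pi * of_int (- k))"
    by (simp add: wave_eq_cis)
  also have "\<dots> = 1"
    by (rule cis_multiple_2pi) auto
  finally show ?thesis .
qed

lemma continuous_on_wave [continuous_intros]: "continuous_on A (wave a)"
  unfolding wave_def by (intro continuous_intros)

lemma borel_measurable_wave [measurable]: "wave a \<in> borel_measurable borel"
  by (intro borel_measurable_continuous_onI continuous_on_wave)

lemma fourier_transform_eq: "fourier_transform \<mu> \<xi> = (CLINT x|\<mu>. wave \<xi> x)"
  by (simp add: fourier_transform_def wave_def)

lemma fourier_transform_eq_char: "fourier_transform \<mu> \<xi> = char \<mu> (- 2 * pi * \<xi>)"
  by (simp add: fourier_transform_def char_def algebra_simps)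

lemma L2_space_measurable: "f \<in> L2_space M \<Longrightarrow> f \<in> borel_measurable M"
  by (simp add: L2_space_def)

lemma L2_space_integrable: "f \<in> L2_space M \<Longrightarrow> integrable M (\<lambda>x. (norm (f x))\<^sup>2)"
  by (simp add: L2_space_def)

lemma norm_add_square_le:
  fixes a b :: "'a::real_normed_vector"
  shows "(norm (a + b))\<^sup>2 \<le> 2 * (norm a)\<^sup>2 + 2 * (norm b)\<^sup>2"
proof -
  have "(norm (a + b))\<^sup>2 \<le> (norm a + norm b)\<^sup>2"
    by (intro power_mono norm_triangle_ineq) auto
  also have "\<dots> \<le> 2 * (norm a)\<^sup>2 + 2 * (norm b)\<^sup>2"
    using zero_le_power2[of "norm a - norm b"] by (simp add: power2_eq_square algebra_simps)
  finally show ?thesis .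
qed

lemma L2_space_add:
  assumes f: "f \<in> L2_space M" and g: "g \<in> L2_space M"
  shows "(\<lambda>x. f x + g x) \<in> L2_space M"
proof -
  note [measurable] = L2_space_measurable[OF f] L2_space_measurable[OF g]
  have "integrable M (\<lambda>x. (norm (f x + g x))\<^sup>2)"
  proof (rule Bochner_Integration.integrable_bound)
    show "integrable M (\<lambda>x. 2 * (norm (f x))\<^sup>2 + 2 * (norm (g x))\<^sup>2)"
      using f g by (auto dest!: L2_space_integrable)
    show "AE x in M. norm ((norm (f x + g x))\<^sup>2) \<le> norm (2 * (norm (f x))\<^sup>2 + 2 * (norm (g x))\<^sup>2)"
      using norm_add_square_le[of "f _" "g _"] by (auto intro!: AE_I2 simp: abs_of_nonneg)
  qed measurable
  then show ?thesis
    by (simp add: L2_space_def)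
qed

lemma L2_space_scale:
  assumes f: "f \<in> L2_space M"
  shows "(\<lambda>x. c * f x) \<in> L2_space M"
  using f by (auto simp: L2_space_def norm_mult power_mult_distrib)

lemma L2_space_diff:
  assumes "f \<in> L2_space M" "g \<in> L2_space M"
  shows "(\<lambda>x. f x - g x) \<in> L2_space M"
  using L2_space_add[OF assms(1) L2_space_scale[OF assms(2), of "-1"]] by simp

lemma L2_space_sum:
  assumes "\<And>i. i \<in> I \<Longrightarrow> f i \<in> L2_space M"
  shows "(\<lambda>x. \<Sum>i\<in>I. f i x) \<in> L2_space M"
  using assms
proof (induction I rule: infinite_finite_induct)
  case (insert i I)
  then have "(\<lambda>x. f i x + (\<Sum>i\<in>I. f i x)) \<in> L2_space M"
    by (intro L2_space_add) auto
  with insert show ?case by simp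
qed (auto simp: L2_space_def)

lemma L2_dist_less_iff:
  assumes "0 < \<epsilon>"
  shows "L2_dist M f g < \<epsilon> \<longleftrightarrow> (LINT x|M. (norm (f x - g x))\<^sup>2) < \<epsilon>\<^sup>2"
  using assms unfolding L2_dist_def
  by (metis abs_of_pos real_sqrt_abs real_sqrt_less_iff)

section \<open>The closed span of a set of characters\<close>

context real_distribution
begin

lemma bounded_L2_space:
  assumes "f \<in> borel_measurable borel" and "\<And>x. norm (f x) \<le> K"
  shows "f \<in> L2_space M"
proof -
  have "norm ((norm (f x))\<^sup>2) \<le> K\<^sup>2" for x
    using assms(2)[of x] by (simp add: power_mono)
  then have "integrable M (\<lambda>x. (norm (f x))\<^sup>2)"
    using assms(1) by (intro integrable_const_bound[where B="K\<^sup>2"]) auto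
  then show ?thesis
    using assms(1) by (simp add: L2_space_def)
qed

lemma wave_L2_space: "wave a \<in> L2_space M"
  by (rule bounded_L2_space[where K=1]) auto

lemma integrable_wave [simp]: "integrable M (wave a)"
  by (rule integrable_const_bound[where B=1]) auto

lemma L2_inner_wave: "L2_inner M (wave a) (wave b) = fourier_transform M (a - b)"
  by (simp add: L2_inner_def fourier_transform_eq wave_minus_left del: cnj_wave)

lemma fourier_transform_0: "fourier_transform M 0 = 1"
  by (simp add: fourier_transform_eq_char char_zero)

lemma fourier_transform_minus: "fourier_transform M (- \<xi>) = cnj (fourier_transform M \<xi>)"
  by (simp add: fourier_transform_eq flip: Bochner_Integration.integral_cnj)

text \<open>Distances are squared, so that no square roots enter the estimates;
  \<open>L2_dist_less_iff\<close> makes the link to \<open>L2_dist\<close>.\<close>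

definition in_closed_span :: "real set \<Rightarrow> (real \<Rightarrow> complex) \<Rightarrow> bool" where
  "in_closed_span S f \<longleftrightarrow> f \<in> L2_space M \<and>
     (\<forall>\<epsilon>>0. \<exists>F c. finite F \<and> F \<subseteq> S \<and>
        (LINT x|M. (norm (f x - (\<Sum>i\<in>F. c i * wave i x)))\<^sup>2) < \<epsilon>)"

lemma in_closed_span_L2_space: "in_closed_span S f \<Longrightarrow> f \<in> L2_space M"
  by (simp add: in_closed_span_def)

lemma wave_sum_L2_space: "(\<lambda>x. \<Sum>i\<in>F. c i * wave i x) \<in> L2_space M"
  by (intro L2_space_sum L2_space_scale wave_L2_space)

lemma L2_norm_add_le:
  assumes "f \<in> L2_space M" "g \<in> L2_space M"
  shows "(LINT x|M. (norm (f x + g x))\<^sup>2)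
    \<le> 2 * (LINT x|M. (norm (f x))\<^sup>2) + 2 * (LINT x|M. (norm (g x))\<^sup>2)"
proof -
  note int = L2_space_integrable[OF assms(1)] L2_space_integrable[OF assms(2)]
  have "(LINT x|M. (norm (f x + g x))\<^sup>2)
    \<le> (LINT x|M. 2 * (norm (f x))\<^sup>2 + 2 * (norm (g x))\<^sup>2)"
    using int L2_space_integrable[OF L2_space_add[OF assms]]
    by (intro integral_mono norm_add_square_le) auto
  also have "\<dots> = 2 * (LINT x|M. (norm (f x))\<^sup>2) + 2 * (LINT x|M. (norm (g x))\<^sup>2)"
    using int by simp
  finally show ?thesis .
qed

text \<open>An approximant of an approximant is an approximant. The two errors \<epsilon> / 4 are
  what the constant 2 in \<open>L2_norm_add_le\<close> allows.\<close>

lemma in_closed_span_approx: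
  assumes f: "f \<in> L2_space M"
    and "\<And>\<epsilon>. 0 < \<epsilon> \<Longrightarrow> \<exists>g. in_closed_span S g \<and> (LINT x|M. (norm (f x - g x))\<^sup>2) < \<epsilon>"
  shows "in_closed_span S f"
  unfolding in_closed_span_def
proof (intro conjI allI impI f)
  fix \<epsilon> :: real assume "0 < \<epsilon>"
  then obtain g where g: "in_closed_span S g" and fg: "(LINT x|M. (norm (f x - g x))\<^sup>2) < \<epsilon> / 4"
    using assms(2)[of "\<epsilon> / 4"] by auto
  obtain F c where F: "finite F" "F \<subseteq> S"
    and gp: "(LINT x|M. (norm (g x - (\<Sum>i\<in>F. c i * wave i x)))\<^sup>2) < \<epsilon> / 4"
    using g \<open>0 < \<epsilon>\<close> unfolding in_closed_span_def by (meson zero_less_divide_iff zero_less_numeral)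
  have "(LINT x|M. (norm ((f x - g x) + (g x - (\<Sum>i\<in>F. c i * wave i x))))\<^sup>2) < \<epsilon>"
    using L2_norm_add_le[OF L2_space_diff[OF f in_closed_span_L2_space[OF g]]
        L2_space_diff[OF in_closed_span_L2_space[OF g] wave_sum_L2_space, of c F]] fg gp
    by simp
  then show "\<exists>F c. finite F \<and> F \<subseteq> S \<and> (LINT x|M. (norm (f x - (\<Sum>i\<in>F. c i * wave i x)))\<^sup>2) < \<epsilon>"
    using F by auto
qed

text \<open>Dominated convergence turns pointwise limits into limits in norm: \<open>f\<close> and
  all \<open>s n\<close> are bounded by the square-integrable \<open>w\<close>, so
  \<open>4 * (w x)\<^sup>2\<close> dominates the squared errors.\<close>

lemma in_closed_span_limit:
  fixes w :: "real \<Rightarrow> real"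
  assumes s: "\<And>n. in_closed_span S (s n)"
    and lim: "\<And>x. (\<lambda>n. s n x) \<longlonglongrightarrow> f x"
    and w: "w \<in> borel_measurable M" "integrable M (\<lambda>x. (w x)\<^sup>2)"
    and bound: "\<And>n x. norm (s n x) \<le> w x"
  shows "in_closed_span S f"
proof -
  have [measurable]: "s n \<in> borel_measurable M" for n
    using s in_closed_span_L2_space L2_space_measurable by blast
  have [measurable]: "f \<in> borel_measurable M"
    by (rule borel_measurable_LIMSEQ_metric[where f=s]) (use lim in auto)
  have fw: "norm (f x) \<le> w x" for x
    by (rule LIMSEQ_le_const2[OF tendsto_norm[OF lim]]) (use bound in auto)
  have wn: "0 \<le> w x" for x
    using bound[of 0 x] norm_ge_zero order_trans by blast
  have L2: "f \<in> L2_space M"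
    unfolding L2_space_def using fw wn
    by (auto intro!: Bochner_Integration.integrable_bound[OF w(2)] power_mono)
  have "(\<lambda>n. LINT x|M. (norm (f x - s n x))\<^sup>2) \<longlonglongrightarrow> (LINT x|M. 0)"
  proof (rule integral_dominated_convergence[where w="\<lambda>x. 4 * (w x)\<^sup>2"])
    show "AE x in M. (\<lambda>n. (norm (f x - s n x))\<^sup>2) \<longlonglongrightarrow> 0"
    proof (rule AE_I2)
      fix x
      have "(\<lambda>n. (norm (f x - s n x))\<^sup>2) \<longlonglongrightarrow> (norm (f x - f x))\<^sup>2"
        by (intro tendsto_intros lim)
      then show "(\<lambda>n. (norm (f x - s n x))\<^sup>2) \<longlonglongrightarrow> 0" by simp
    qed
    show "AE x in M. norm ((norm (f x - s n x))\<^sup>2) \<le> 4 * (w x)\<^sup>2" for n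
    proof (rule AE_I2)
      fix x
      have "norm (f x - s n x) \<le> 2 * w x"
        using norm_triangle_ineq4[of "f x" "s n x"] fw[of x] bound[of n x] by linarith
      then have "(norm (f x - s n x))\<^sup>2 \<le> (2 * w x)\<^sup>2"
        by (intro power_mono) auto
      then show "norm ((norm (f x - s n x))\<^sup>2) \<le> 4 * (w x)\<^sup>2"
        by (simp add: power_mult_distrib)
    qed
  qed (use w in auto)
  then have lim0: "(\<lambda>n. LINT x|M. (norm (f x - s n x))\<^sup>2) \<longlonglongrightarrow> 0" by simp
  show ?thesis
  proof (rule in_closed_span_approx[OF L2])
    fix \<epsilon> :: real assume "0 < \<epsilon>"
    then have "eventually (\<lambda>n. (LINT x|M. (norm (f x - s n x))\<^sup>2) < \<epsilon>) sequentially"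
      using order_tendstoD(2)[OF lim0] by auto
    then show "\<exists>g. in_closed_span S g \<and> (LINT x|M. (norm (f x - g x))\<^sup>2) < \<epsilon>"
      using s by (auto simp: eventually_sequentially)
  qed
qed

lemma in_closed_span_bounded_limit:
  fixes K :: real
  assumes "\<And>n. in_closed_span S (s n)" "\<And>x. (\<lambda>n. s n x) \<longlonglongrightarrow> f x" "\<And>n x. norm (s n x) \<le> K"
  shows "in_closed_span S f"
  by (rule in_closed_span_limit[of S s f "\<lambda>_. K"]) (use assms in auto)

lemma in_closed_span_scale:
  assumes f: "in_closed_span S f"
  shows "in_closed_span S (\<lambda>x. a * f x)"
  unfolding in_closed_span_def
proof (intro conjI allI impI L2_space_scale in_closed_span_L2_space[OF f])
  fix \<epsilon> :: real assume \<epsilon>: "0 < \<epsilon>"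
  \<comment> \<open>The summand 1 keeps \<open>k\<close> positive when \<open>a = 0\<close>, so that
    dividing by it is safe.\<close>
  define k where "k = (norm a)\<^sup>2 + 1"
  have k: "k > 0" "(norm a)\<^sup>2 \<le> k" by (auto simp: k_def add_nonneg_pos)
  obtain F c where F: "finite F" "F \<subseteq> S"
    and fp: "(LINT x|M. (norm (f x - (\<Sum>i\<in>F. c i * wave i x)))\<^sup>2) < \<epsilon> / k"
    using f \<epsilon> k unfolding in_closed_span_def by (meson zero_less_divide_iff)
  have "(\<Sum>i\<in>F. a * c i * wave i x) = a * (\<Sum>i\<in>F. c i * wave i x)" for x
    by (simp add: sum_distrib_left mult.assoc)
  then have "a * f x - (\<Sum>i\<in>F. a * c i * wave i x) = a * (f x - (\<Sum>i\<in>F. c i * wave i x))" for x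
    by (simp add: algebra_simps)
  then have "(LINT x|M. (norm (a * f x - (\<Sum>i\<in>F. a * c i * wave i x)))\<^sup>2)
     = (norm a)\<^sup>2 * (LINT x|M. (norm (f x - (\<Sum>i\<in>F. c i * wave i x)))\<^sup>2)"
    by (simp add: norm_mult power_mult_distrib)
  also have "\<dots> \<le> k * (LINT x|M. (norm (f x - (\<Sum>i\<in>F. c i * wave i x)))\<^sup>2)"
    using k by (intro mult_right_mono) auto
  also have "\<dots> < \<epsilon>"
    using fp k by (simp add: field_simps)
  finally show "\<exists>F c. finite F \<and> F \<subseteq> S \<and>
      (LINT x|M. (norm (a * f x - (\<Sum>i\<in>F. c i * wave i x)))\<^sup>2) < \<epsilon>"
    using F by (intro exI[of _ F] exI[of _ "\<lambda>i. a * c i"]) auto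
qed

lemma in_closed_span_add:
  assumes f: "in_closed_span S f" and g: "in_closed_span S g"
  shows "in_closed_span S (\<lambda>x. f x + g x)"
  unfolding in_closed_span_def
proof (intro conjI allI impI L2_space_add in_closed_span_L2_space[OF f] in_closed_span_L2_space[OF g])
  fix \<epsilon> :: real assume \<epsilon>: "0 < \<epsilon>"
  obtain F c where F: "finite F" "F \<subseteq> S"
    and fp: "(LINT x|M. (norm (f x - (\<Sum>i\<in>F. c i * wave i x)))\<^sup>2) < \<epsilon> / 4"
    using f \<epsilon> unfolding in_closed_span_def by (meson zero_less_divide_iff zero_less_numeral)
  obtain G d where G: "finite G" "G \<subseteq> S"
    and gp: "(LINT x|M. (norm (g x - (\<Sum>i\<in>G. d i * wave i x)))\<^sup>2) < \<epsilon> / 4"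
    using g \<epsilon> unfolding in_closed_span_def by (meson zero_less_divide_iff zero_less_numeral)
  \<comment> \<open>Both coefficient families are extended by zero, so that frequencies common to
    \<open>F\<close> and \<open>G\<close> receive both contributions.\<close>
  define e where "e i = (if i \<in> F then c i else 0) + (if i \<in> G then d i else 0)" for i
  have "(\<Sum>i\<in>F \<union> G. e i * wave i x) = (\<Sum>i\<in>F. c i * wave i x) + (\<Sum>i\<in>G. d i * wave i x)" for x
  proof -
    have "(\<Sum>i\<in>F \<union> G. e i * wave i x) = (\<Sum>i\<in>F \<union> G. if i \<in> F then c i * wave i x else 0)
        + (\<Sum>i\<in>F \<union> G. if i \<in> G then d i * wave i x else 0)"
      by (simp flip: sum.distrib add: e_def algebra_simps) (rule sum.cong, auto simp: algebra_simps)
    also have "(\<Sum>i\<in>F \<union> G. if i \<in> F then c i * wave i x else 0) = (\<Sum>i\<in>F. c i * wave i x)"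
      using F G by (subst sum.inter_restrict[symmetric]) (auto intro!: sum.cong)
    also have "(\<Sum>i\<in>F \<union> G. if i \<in> G then d i * wave i x else 0) = (\<Sum>i\<in>G. d i * wave i x)"
      using F G by (subst sum.inter_restrict[symmetric]) (auto intro!: sum.cong)
    finally show ?thesis .
  qed
  then have eq: "f x + g x - (\<Sum>i\<in>F \<union> G. e i * wave i x)
      = (f x - (\<Sum>i\<in>F. c i * wave i x)) + (g x - (\<Sum>i\<in>G. d i * wave i x))" for x
    by simp
  have "(LINT x|M. (norm (f x + g x - (\<Sum>i\<in>F \<union> G. e i * wave i x)))\<^sup>2) < \<epsilon>"
    unfolding eq
    using L2_norm_add_le[OF L2_space_diff[OF in_closed_span_L2_space[OF f] wave_sum_L2_space, of c F]
        L2_space_diff[OF in_closed_span_L2_space[OF g] wave_sum_L2_space, of d G]] fp gp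
    by linarith
  then show "\<exists>F c. finite F \<and> F \<subseteq> S \<and>
      (LINT x|M. (norm (f x + g x - (\<Sum>i\<in>F. c i * wave i x)))\<^sup>2) < \<epsilon>"
    using F G by (intro exI[of _ "F \<union> G"] exI[of _ e]) auto
qed

lemma in_closed_span_diff:
  assumes "in_closed_span S f" "in_closed_span S g"
  shows "in_closed_span S (\<lambda>x. f x - g x)"
  using in_closed_span_add[OF assms(1) in_closed_span_scale[OF assms(2), of "-1"]] by simp

lemma in_closed_span_zero: "in_closed_span S (\<lambda>x. 0)"
  unfolding in_closed_span_def L2_space_def by (auto intro!: exI[of _ "{}"])

lemma in_closed_span_sum:
  assumes "\<And>i. i \<in> I \<Longrightarrow> in_closed_span S (f i)"
  shows "in_closed_span S (\<lambda>x. \<Sum>i\<in>I. f i x)"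
  using assms
proof (induction I rule: infinite_finite_induct)
  case (insert i I)
  then have "in_closed_span S (\<lambda>x. f i x + (\<Sum>i\<in>I. f i x))"
    by (intro in_closed_span_add) auto
  with insert show ?case by simp
qed (simp_all add: in_closed_span_zero)

lemma sin_eq_wave:
  "complex_of_real (sin (a * x)) = (\<i> / 2) * (wave (a / (2 * pi)) x - wave (- a / (2 * pi)) x)"
  by (simp add: wave_eq_cis complex_eq_iff)

text \<open>Once all characters lie in the closed span of the characters from \<open>S\<close>, so does everything:
  polynomials in \<open>sin (x / n)\<close> do, hence \<open>\<phi> (n sin (x / n))\<close> for continuous \<open>\<phi>\<close>, and for bounded
  \<open>\<phi>\<close> these converge boundedly to \<open>\<phi>\<close>.\<close>

context
  fixes S :: "real set"
  assumes waves: "\<And>a. in_closed_span S (wave a)"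
begin

text \<open>A sine is a combination of two characters, so one more factor only shifts the frequency;
  leaving \<open>b\<close> free makes the induction work.\<close>

lemma sin_power_wave_in_closed_span:
  "in_closed_span S (\<lambda>x. of_real (sin (a * x)) ^ k * wave b x)"
proof (induction k arbitrary: b)
  case (Suc k)
  have "in_closed_span S (\<lambda>x. (\<i> / 2) * (of_real (sin (a * x)) ^ k * wave (a / (2 * pi) + b) x
      - of_real (sin (a * x)) ^ k * wave (- a / (2 * pi) + b) x))"
    by (intro in_closed_span_scale in_closed_span_diff Suc)
  also have "(\<lambda>x. (\<i> / 2) * (of_real (sin (a * x)) ^ k * wave (a / (2 * pi) + b) x
      - of_real (sin (a * x)) ^ k * wave (- a / (2 * pi) + b) x))
    = (\<lambda>x. of_real (sin (a * x)) ^ Suc k * wave b x)"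
    unfolding wave_add_left power_Suc sin_eq_wave by (simp add: algebra_simps)
  finally show ?case .
qed (simp add: waves)

text \<open>The values of \<open>r * sin (x / r)\<close> stay in the compact interval from
  \<open>- r\<close> to \<open>r\<close>, where \<open>\<phi>\<close> is a uniform limit of
  polynomials; composed with this function, these become polynomials in the sine.\<close>

lemma continuous_sin_in_closed_span:
  fixes \<phi> :: "real \<Rightarrow> real"
  assumes \<phi>: "continuous_on UNIV \<phi>" and r: "0 < r"
  shows "in_closed_span S (\<lambda>x. of_real (\<phi> (r * sin (x / r))))"
proof -
  have cpt: "compact {-r..r}" and cont: "continuous_on {-r..r} \<phi>"
    using \<phi> continuous_on_subset by auto
  have mem: "r * sin (x / r) \<in> {-r..r}" for x
    using r mult_left_mono[OF sin_le_one, of r "x / r"] mult_left_mono[OF sin_ge_minus_one, of r "x / r"]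
    by auto
  have "\<exists>p. real_polynomial_function p \<and> (\<forall>x\<in>{-r..r}. \<bar>\<phi> x - p x\<bar> < 1 / real (Suc n))" for n
    using Stone_Weierstrass_real_polynomial_function[OF cpt cont, of "1 / real (Suc n)"]
    by (metis of_nat_0_less_iff zero_less_Suc zero_less_divide_1_iff)
  then obtain p where p: "\<And>n. real_polynomial_function (p n)"
    and close: "\<And>n x. x \<in> {-r..r} \<Longrightarrow> \<bar>\<phi> x - p n x\<bar> < 1 / real (Suc n)"
    by metis
  have span: "in_closed_span S (\<lambda>x. of_real (p n (r * sin (x / r))))" for n
  proof -
    obtain a m where "p n = (\<lambda>x. \<Sum>i\<le>m. a i * x ^ i)"
      using p[of n] unfolding real_polynomial_function_iff_sum by auto
    then have eq: "(\<lambda>x. complex_of_real (p n (r * sin (x / r)))) =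
        (\<lambda>x. \<Sum>i\<le>m. of_real (a i * r ^ i) * (of_real (sin ((1 / r) * x)) ^ i * wave 0 x))"
      by (simp add: power_mult_distrib mult.assoc)
    show ?thesis
      unfolding eq by (intro in_closed_span_sum in_closed_span_scale sin_power_wave_in_closed_span)
  qed
  have "compact (\<phi> ` {-r..r})"
    using compact_continuous_image[OF cont cpt] .
  then obtain K where K: "\<And>x. x \<in> {-r..r} \<Longrightarrow> \<bar>\<phi> x\<bar> \<le> K"
    using compact_imp_bounded by (force simp: bounded_iff)
  show ?thesis
  proof (rule in_closed_span_bounded_limit[OF span])
    fix x
    define y where "y = r * sin (x / r)"
    have "(\<lambda>n. p n y - \<phi> y) \<longlonglongrightarrow> 0"
    proof (rule Lim_null_comparison[OF _ LIMSEQ_inverse_real_of_nat])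
      show "eventually (\<lambda>n. norm (p n y - \<phi> y) \<le> inverse (real (Suc n))) sequentially"
        using close[of y] mem[of x] unfolding y_def
        by (auto simp: abs_minus_commute inverse_eq_divide intro!: always_eventually less_imp_le)
    qed
    then have "(\<lambda>n. p n y) \<longlonglongrightarrow> \<phi> y"
      by (simp add: LIM_zero_iff)
    then show "(\<lambda>n. complex_of_real (p n (r * sin (x / r)))) \<longlonglongrightarrow> of_real (\<phi> (r * sin (x / r)))"
      unfolding y_def by (intro tendsto_intros)
    fix n
    have "\<bar>\<phi> y - p n y\<bar> < 1 / real (Suc n)" "\<bar>\<phi> y\<bar> \<le> K"
      using close[of y] mem[of x] K[of y] unfolding y_def by auto
    moreover have "1 / real (Suc n) \<le> 1" by simp
    ultimately have "\<bar>p n y\<bar> \<le> K + 1" by linarith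
    then show "norm (complex_of_real (p n (r * sin (x / r)))) \<le> K + 1"
      by (simp add: y_def)
  qed
qed

lemma bounded_continuous_in_closed_span:
  fixes \<phi> :: "real \<Rightarrow> real"
  assumes \<phi>: "continuous_on UNIV \<phi>" and K: "\<And>x. \<bar>\<phi> x\<bar> \<le> K"
  shows "in_closed_span S (\<lambda>x. of_real (\<phi> x))"
proof (rule in_closed_span_bounded_limit)
  show "in_closed_span S (\<lambda>x. of_real (\<phi> (real (Suc n) * sin (x / real (Suc n)))))" for n
    by (rule continuous_sin_in_closed_span[OF \<phi>]) simp
  show "norm (complex_of_real (\<phi> (real (Suc n) * sin (x / real (Suc n))))) \<le> K" for n x
    using K by simp
  fix x
  have "(\<lambda>n. real n * sin (x / real n)) \<longlonglongrightarrow> x"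
    by real_asymp
  then have "(\<lambda>n. real (Suc n) * sin (x / real (Suc n))) \<longlonglongrightarrow> x"
    by (rule LIMSEQ_Suc)
  then have "(\<lambda>n. \<phi> (real (Suc n) * sin (x / real (Suc n)))) \<longlonglongrightarrow> \<phi> x"
    using \<phi> by (intro isCont_tendsto_compose[of _ \<phi>]) (auto simp: continuous_on_eq_continuous_at)
  then show "(\<lambda>n. complex_of_real (\<phi> (real (Suc n) * sin (x / real (Suc n))))) \<longlonglongrightarrow> of_real (\<phi> x)"
    by (intro tendsto_intros)
qed

text \<open>Continuous ramps, equal to 1 up to \<open>a\<close> and then falling to 0 with slope
  \<open>- n\<close>, decrease pointwise to the indicator.\<close>

lemma indicator_atMost_in_closed_span: "in_closed_span S (indicator {..a})"
proof (rule in_closed_span_bounded_limit)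
  show "in_closed_span S (\<lambda>x. of_real (max 0 (min 1 (1 - real n * (x - a)))))" for n
    by (rule bounded_continuous_in_closed_span[where K=1]) (auto intro!: continuous_intros)
  show "norm (complex_of_real (max 0 (min 1 (1 - real n * (x - a))))) \<le> 1" for n x
    by simp
  fix x
  show "(\<lambda>n. complex_of_real (max 0 (min 1 (1 - real n * (x - a))))) \<longlonglongrightarrow> indicator {..a} x"
  proof (cases "x \<le> a")
    case True
    then have "max 0 (min 1 (1 - real n * (x - a))) = 1" for n
      by (auto simp: mult_nonneg_nonpos)
    with True show ?thesis by simp
  next
    case False
    obtain m where m: "1 < real m * (x - a)"
      using False ex_less_of_nat_mult[of "x - a" 1] by auto
    have "max 0 (min 1 (1 - real n * (x - a))) = 0" if "m \<le> n" for n
    proof -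
      have "real m * (x - a) \<le> real n * (x - a)"
        using that False by (intro mult_right_mono) auto
      with m show ?thesis by linarith
    qed
    then have "eventually (\<lambda>n. complex_of_real (max 0 (min 1 (1 - real n * (x - a)))) = 0) sequentially"
      unfolding eventually_sequentially by (metis of_real_0)
    with False show ?thesis
      by (simp add: tendsto_eventually)
  qed
qed

text \<open>Dynkin's lemma: half-lines form a generator of the Borel sets closed under intersection,
  and the sets with indicator in the closed span are closed under complements and countable disjoint
  unions.\<close>

lemma indicator_in_closed_span:
  assumes "A \<in> sets borel"
  shows "in_closed_span S (indicator A)"
proof -
  have "Int_stable (range (\<lambda>a::real. {..a}))"
    by (auto simp: Int_stable_def)
  moreover have "range (\<lambda>a::real. {..a}) \<subseteq> Pow UNIV" by simp
  moreover have "A \<in> sigma_sets UNIV (range (\<lambda>a::real. {..a}))"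
    using assms unfolding borel_eq_atMost by simp
  ultimately show ?thesis
  proof (induction rule: sigma_sets_induct_disjoint)
    case (basic A)
    then show ?case by (auto intro: indicator_atMost_in_closed_span)
  next
    case empty
    then show ?case by (simp add: in_closed_span_zero)
  next
    case (compl A)
    have "(indicator (UNIV - A) :: real \<Rightarrow> complex) = (\<lambda>x. wave 0 x - indicator A x)"
      by (auto simp: fun_eq_iff indicator_def)
    then show ?case
      using in_closed_span_diff[OF waves[of 0] compl(2)] by simp
  next
    case (union A)
    show ?case
    proof (rule in_closed_span_bounded_limit)
      have eq: "(\<lambda>x. \<Sum>i<n. indicator (A i) x) = (indicator (\<Union>i<n. A i) :: real \<Rightarrow> complex)" for n
        using union(1) by (intro ext indicator_UN_disjoint[symmetric])
          (auto simp: disjoint_family_on_def)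
      show "in_closed_span S (indicator (\<Union>i<n. A i))" for n
        unfolding eq[symmetric] by (intro in_closed_span_sum union)
      show "(\<lambda>n. indicator (\<Union>i<n. A i) x :: complex) \<longlonglongrightarrow> indicator (\<Union>i. A i) x" for x
        by (rule LIMSEQ_indicator_UN)
      show "norm (indicator (\<Union>i<n. A i) x :: complex) \<le> 1" for n x
        by (simp add: indicator_def)
    qed
  qed
qed

text \<open>Simple functions converge to \<open>f\<close> pointwise under the square-integrable
  bound \<open>2 * norm (f x)\<close>, and each is a finite combination of indicators of Borel
  sets.\<close>

lemma L2_space_in_closed_span:
  assumes f: "f \<in> L2_space M"
  shows "in_closed_span S f"
proof -
  obtain s where s: "\<And>i. simple_function M (s i)"
    and lim: "\<And>x. (\<lambda>i. s i x) \<longlonglongrightarrow> f x"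
    and bd: "\<And>i x. dist (s i x) 0 \<le> 2 * dist (f x) 0"
    using borel_measurable_implies_sequence_metric[OF L2_space_measurable[OF f], of 0] by auto
  have span: "in_closed_span S (s i)" for i
  proof -
    have fin: "finite (range (s i))"
      using simple_functionD(1)[OF s[of i]] by simp
    have eq: "s i = (\<lambda>x. \<Sum>y\<in>range (s i). y * indicator (s i -` {y}) x)"
    proof
      fix x
      have "(\<Sum>y\<in>range (s i). y * indicator (s i -` {y}) x)
        = (\<Sum>y\<in>range (s i). if s i x = y then y else 0)"
        by (intro sum.cong) (auto simp: indicator_def)
      then show "s i x = (\<Sum>y\<in>range (s i). y * indicator (s i -` {y}) x)"
        using fin by simp
    qed
    have "s i -` {y} \<in> sets borel" for y
      using simple_functionD(2)[OF s[of i], of "{y}"] by simp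
    then show ?thesis
      by (subst eq) (intro in_closed_span_sum in_closed_span_scale indicator_in_closed_span)
  qed
  note [measurable] = L2_space_measurable[OF f]
  show ?thesis
    by (rule in_closed_span_limit[OF span lim, of "\<lambda>x. 2 * norm (f x)"])
      (use bd L2_space_integrable[OF f] in \<open>auto simp: power_mult_distrib\<close>)
qed

end

section \<open>The Parseval criterion for a spectrum\<close>

text \<open>For orthonormal characters the squared distance from \<open>wave \<xi>\<close> to its
  projection on the span of those in \<open>F\<close> is 1 minus the sum of the squared moduli of
  its coefficients, which \<open>total\<close> makes small.\<close>

lemma wave_in_closed_span:
  assumes orth: "\<And>a b. a \<in> S \<Longrightarrow> b \<in> S \<Longrightarrow> a \<noteq> b \<Longrightarrow> fourier_transform M (a - b) = 0"
    and total: "\<And>\<epsilon>. 0 < \<epsilon> \<Longrightarrow> \<exists>F. finite F \<and> F \<subseteq> S \<and>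
        1 - \<epsilon> < (\<Sum>i\<in>F. (norm (fourier_transform M (i - \<xi>)))\<^sup>2)"
  shows "in_closed_span S (wave \<xi>)"
  unfolding in_closed_span_def
proof (intro conjI allI impI wave_L2_space)
  fix \<epsilon> :: real assume "0 < \<epsilon>"
  then obtain F where F: "finite F" "F \<subseteq> S"
    and big: "1 - \<epsilon> < (\<Sum>i\<in>F. (norm (fourier_transform M (i - \<xi>)))\<^sup>2)"
    using total by blast
  \<comment> \<open>The coefficient of \<open>wave \<xi>\<close> along \<open>wave i\<close>, by
    \<open>L2_inner_wave\<close>.\<close>
  define c where "c i = fourier_transform M (\<xi> - i)" for i
  have norm_c: "norm (fourier_transform M (i - \<xi>)) = norm (c i)" for i
    using fourier_transform_minus[of "\<xi> - i"] by (simp add: c_def)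
  have c_cnj: "fourier_transform M (i - \<xi>) = cnj (c i)" for i
    using fourier_transform_minus[of "\<xi> - i"] by (simp add: c_def)
  define p where "p x = (\<Sum>i\<in>F. c i * wave i x)" for x
  have expand: "complex_of_real ((norm (wave \<xi> x - p x))\<^sup>2) =
      1 - (\<Sum>i\<in>F. cnj (c i) * wave (\<xi> - i) x) - (\<Sum>i\<in>F. c i * wave (i - \<xi>) x)
      + (\<Sum>i\<in>F. \<Sum>j\<in>F. c i * cnj (c j) * wave (i - j) x)" for x
  proof -
    have "complex_of_real ((norm (wave \<xi> x - p x))\<^sup>2) = (wave \<xi> x - p x) * cnj (wave \<xi> x - p x)"
      by (rule complex_norm_square)
    also have "\<dots> = wave \<xi> x * cnj (wave \<xi> x) - wave \<xi> x * cnj (p x) - p x * cnj (wave \<xi> x)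
        + p x * cnj (p x)"
      by (simp add: algebra_simps)
    also have "wave \<xi> x * cnj (wave \<xi> x) = 1"
      by (simp add: wave_minus_left[symmetric] del: cnj_wave)
    also have "wave \<xi> x * cnj (p x) = (\<Sum>i\<in>F. cnj (c i) * wave (\<xi> - i) x)"
      by (simp add: p_def sum_distrib_left wave_minus_left algebra_simps)
    also have "p x * cnj (wave \<xi> x) = (\<Sum>i\<in>F. c i * wave (i - \<xi>) x)"
      by (simp add: p_def sum_distrib_left sum_distrib_right wave_minus_left algebra_simps)
    also have "p x * cnj (p x) = (\<Sum>i\<in>F. \<Sum>j\<in>F. c i * cnj (c j) * wave (i - j) x)"
      by (simp add: p_def sum_product wave_minus_left algebra_simps)
    finally show ?thesis .
  qed
  have "complex_of_real (LINT x|M. (norm (wave \<xi> x - p x))\<^sup>2)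
      = (CLINT x|M. complex_of_real ((norm (wave \<xi> x - p x))\<^sup>2))"
    by (rule integral_complex_of_real[symmetric])
  also have "\<dots> = 1 - (\<Sum>i\<in>F. cnj (c i) * fourier_transform M (\<xi> - i))
      - (\<Sum>i\<in>F. c i * fourier_transform M (i - \<xi>))
      + (\<Sum>i\<in>F. \<Sum>j\<in>F. c i * cnj (c j) * fourier_transform M (i - j))"
    unfolding expand fourier_transform_eq by (simp add: prob_space del: space_eq_univ)
  also have "(\<Sum>i\<in>F. \<Sum>j\<in>F. c i * cnj (c j) * fourier_transform M (i - j)) = (\<Sum>i\<in>F. c i * cnj (c i))"
  proof (intro sum.cong refl)
    fix i assume i: "i \<in> F"
    have "(\<Sum>j\<in>F. c i * cnj (c j) * fourier_transform M (i - j))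
      = (\<Sum>j\<in>F. if i = j then c i * cnj (c i) else 0)"
      using orth F i by (intro sum.cong) (auto simp: fourier_transform_0)
    then show "(\<Sum>j\<in>F. c i * cnj (c j) * fourier_transform M (i - j)) = c i * cnj (c i)"
      using F i by simp
  qed
  also have "1 - (\<Sum>i\<in>F. cnj (c i) * fourier_transform M (\<xi> - i))
      - (\<Sum>i\<in>F. c i * fourier_transform M (i - \<xi>)) + (\<Sum>i\<in>F. c i * cnj (c i))
    = complex_of_real (1 - (\<Sum>i\<in>F. (norm (c i))\<^sup>2))"
    unfolding c_cnj c_def[symmetric] of_real_diff of_real_sum complex_norm_square
    by (simp add: mult.commute)
  finally have "(LINT x|M. (norm (wave \<xi> x - p x))\<^sup>2) = 1 - (\<Sum>i\<in>F. (norm (c i))\<^sup>2)"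
    unfolding of_real_eq_iff .
  then have "(LINT x|M. (norm (wave \<xi> x - p x))\<^sup>2) < \<epsilon>"
    using big by (simp add: norm_c)
  then show "\<exists>F c. finite F \<and> F \<subseteq> S \<and>
      (LINT x|M. (norm (wave \<xi> x - (\<Sum>i\<in>F. c i * wave i x)))\<^sup>2) < \<epsilon>"
    using F unfolding p_def by blast
qed

text \<open>The criterion of Jorgensen and Pedersen, with the identity "the sum equals 1" replaced
  by a lower bound on finite sums; the upper bound is Bessel's inequality. Approximating all
  characters is enough by \<open>L2_space_in_closed_span\<close>.\<close>

theorem is_spectrumI:
  assumes "countable S"
    and orth: "\<And>a b. a \<in> S \<Longrightarrow> b \<in> S \<Longrightarrow> a \<noteq> b \<Longrightarrow> fourier_transform M (a - b) = 0"
    and total: "\<And>\<xi> \<epsilon>. 0 < \<epsilon> \<Longrightarrow> \<exists>F. finite F \<and> F \<subseteq> S \<and>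
        1 - \<epsilon> < (\<Sum>i\<in>F. (norm (fourier_transform M (\<xi> + i)))\<^sup>2)"
  shows "is_spectrum M S"
proof -
  have waves: "in_closed_span S (wave \<xi>)" for \<xi>
  proof (rule wave_in_closed_span[OF orth])
    show "\<exists>F. finite F \<and> F \<subseteq> S \<and> 1 - \<epsilon> < (\<Sum>i\<in>F. (norm (fourier_transform M (i - \<xi>)))\<^sup>2)"
      if "0 < \<epsilon>" for \<epsilon>
      using total[OF that, of "- \<xi>"] by simp
  qed auto
  have "L2_orthonormal_basis M S wave"
    unfolding L2_orthonormal_basis_def
  proof (intro conjI ballI allI impI)
    show "wave i \<in> L2_space M" for i
      by (rule wave_L2_space)
    show "L2_inner M (wave i) (wave j) = of_bool (i = j)" if "i \<in> S" "j \<in> S" for i j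
      using orth that by (auto simp: L2_inner_wave fourier_transform_0)
    fix f \<epsilon> assume "f \<in> L2_space M" "(0::real) < \<epsilon>"
    with L2_space_in_closed_span[OF waves]
    show "\<exists>F c. finite F \<and> F \<subseteq> S \<and> L2_dist M f (\<lambda>x. \<Sum>i\<in>F. c i * wave i x) < \<epsilon>"
      unfolding in_closed_span_def L2_dist_less_iff[OF \<open>0 < \<epsilon>\<close>] by (meson zero_less_power)
  qed
  then show ?thesis
    using assms(1) real_distribution_axioms unfolding is_spectrum_def wave_def by simp
qed

end

section \<open>Fourier transforms of convolutions\<close>

lemma real_distribution_convolution:
  assumes "real_distribution M" "real_distribution K"
  shows "real_distribution (M \<star> K)"
proof -
  interpret M: real_distribution M by fact
  interpret K: real_distribution K by fact
  interpret pair_prob_space M K ..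
  show ?thesis
    unfolding convolution_def by (intro real_distribution_distr) measurable
qed

lemma fourier_transform_convolution:
  assumes "real_distribution M" "real_distribution K"
  shows "fourier_transform (M \<star> K) \<xi> = fourier_transform M \<xi> * fourier_transform K \<xi>"
proof -
  interpret M: real_distribution M by fact
  interpret K: real_distribution K by fact
  interpret pair_prob_space M K ..
  have int: "integrable (M \<Otimes>\<^sub>M K) (\<lambda>z. wave \<xi> (fst z + snd z))"
    by (rule integrable_const_bound[where B=1]) auto
  have "fourier_transform (M \<star> K) \<xi> = (CLINT z|M \<Otimes>\<^sub>M K. wave \<xi> (fst z + snd z))"
    unfolding fourier_transform_eq convolution_def
    by (subst integral_distr) (auto simp: case_prod_beta)
  also have "\<dots> = (CLINT x|M. CLINT y|K. wave \<xi> (x + y))"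
    using integral_fst'[OF int] by simp
  also have "\<dots> = fourier_transform M \<xi> * fourier_transform K \<xi>"
    by (simp add: wave_add_right fourier_transform_eq)
  finally show ?thesis .
qed

section \<open>Masks, denominators and partial products\<close>

text \<open>The mask polynomial of \<open>D\<close>: for finite nonempty \<open>D\<close> it is the
  Fourier transform of \<open>uniform_discrete D\<close>.\<close>

definition mask :: "real set \<Rightarrow> real \<Rightarrow> complex" where
  "mask D \<xi> = (\<Sum>b\<in>D. wave \<xi> b) / of_nat (card D)"

lemma real_distribution_uniform_discrete: "real_distribution (uniform_discrete D)"
  unfolding uniform_discrete_def by (rule prob_space.real_distribution_distr[OF measure_pmf.prob_space_axioms]) simp

lemma fourier_transform_uniform_discrete:
  assumes "finite D" "D \<noteq> {}"
  shows "fourier_transform (uniform_discrete D) \<xi> = mask D \<xi>"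
proof -
  have "fourier_transform (uniform_discrete D) \<xi> = (CLINT x|measure_pmf (pmf_of_set D). wave \<xi> x)"
    unfolding fourier_transform_eq uniform_discrete_def by (subst integral_distr) auto
  also have "\<dots> = (\<Sum>a\<in>D. pmf (pmf_of_set D) a *\<^sub>R wave \<xi> a)"
    using assms by (intro integral_measure_pmf) auto
  also have "\<dots> = mask D \<xi>"
    using assms by (simp add: mask_def scaleR_conv_of_real sum_divide_distrib)
  finally show ?thesis .
qed

lemma mask_0:
  assumes "finite D" "D \<noteq> {}"
  shows "mask D 0 = 1"
  using assms by (simp add: mask_def)

lemma norm_mask_le_1: "norm (mask D \<xi>) \<le> 1"
proof -
  have "norm (\<Sum>b\<in>D. wave \<xi> b) \<le> (\<Sum>b\<in>D. norm (wave \<xi> b))"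
    by (rule norm_sum)
  also have "\<dots> = real (card D)"
    by simp
  finally have "norm (mask D \<xi>) \<le> real (card D) / real (card D)"
    unfolding mask_def norm_divide norm_of_nat by (rule divide_right_mono) simp
  also have "\<dots> \<le> 1"
    by simp
  finally show ?thesis .
qed

lemma mask_image_divide:
  assumes "c \<noteq> 0"
  shows "mask ((\<lambda>b. b / c) ` D) \<xi> = mask D (\<xi> / c)"
proof -
  have "inj_on (\<lambda>b. b / c) D"
    using assms by (simp add: inj_on_def)
  then show ?thesis
    by (simp add: mask_def sum.reindex card_image wave_def)
qed

definition denom :: "(nat \<Rightarrow> nat) \<Rightarrow> nat \<Rightarrow> real" where
  "denom N n = (\<Prod>i<n. real (N i))"

lemma denom_0 [simp]: "denom N 0 = 1"
  and denom_Suc: "denom N (Suc n) = denom N n * real (N n)"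
  by (simp_all add: denom_def)

lemma denom_add: "denom N (n + m) = denom N n * denom (\<lambda>i. N (n + i)) m"
  by (induction m) (simp_all add: denom_Suc)

lemma denom_Ints: "denom N n \<in> \<int>"
  unfolding denom_def by (rule Ints_prod) auto

text \<open>The Fourier transform of \<open>finite_convolution N B n\<close>. Factor
  \<open>j\<close> carries \<open>denom N (Suc j)\<close>, since its digits are divided by all bases
  up to and including \<open>N j\<close>.\<close>

definition partial_ft :: "(nat \<Rightarrow> nat) \<Rightarrow> (nat \<Rightarrow> real set) \<Rightarrow> nat \<Rightarrow> real \<Rightarrow> complex" where
  "partial_ft N B n \<xi> = (\<Prod>j<n. mask (B j) (\<xi> / denom N (Suc j)))"

lemma partial_ft_0 [simp]: "partial_ft N B 0 \<xi> = 1"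
  and partial_ft_Suc: "partial_ft N B (Suc n) \<xi> = partial_ft N B n \<xi> * mask (B n) (\<xi> / denom N (Suc n))"
  by (simp_all add: partial_ft_def)

lemma norm_partial_ft_le_1: "norm (partial_ft N B n \<xi>) \<le> 1"
  unfolding partial_ft_def prod_norm[symmetric] by (intro prod_le_1) (simp add: norm_mask_le_1)

text \<open>Dividing the frequency by the first \<open>n\<close> bases turns the later factors into
  those of the shifted sequence, that is, of the tail.\<close>

lemma partial_ft_add:
  "partial_ft N B (n + m) \<xi> =
    partial_ft N B n \<xi> * partial_ft (\<lambda>i. N (n + i)) (\<lambda>i. B (n + i)) m (\<xi> / denom N n)"
proof (induction m)
  case (Suc m)
  have "\<xi> / denom N (n + Suc m) = \<xi> / denom N n / denom (\<lambda>i. N (n + i)) (Suc m)"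
    unfolding denom_add by simp
  with Suc show ?case
    by (simp add: partial_ft_Suc del: divide_divide_eq_left)
qed simp

locale digit_sequence =
  fixes N :: "nat \<Rightarrow> nat" and B :: "nat \<Rightarrow> real set"
  assumes N_ge_2: "2 \<le> N k"
    and finite_B: "finite (B k)"
    and card_B: "2 \<le> card (B k)"
    and B_Ints: "B k \<subseteq> \<int>"
begin

lemma B_nonempty: "B k \<noteq> {}"
  using card_B[of k] by auto

lemma denom_pos: "0 < denom N n"
  unfolding denom_def using order_less_le_trans[OF pos2 N_ge_2] by (intro prod_pos) simp

lemma denom_ge: "real n \<le> denom N n"
proof -
  have "2 ^ n \<le> denom N n"
  proof (induction n)
    case (Suc n)
    have "2 ^ n * 2 \<le> denom N n * real (N n)"
      using Suc N_ge_2[of n] denom_pos[of n] by (intro mult_mono) auto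
    then show ?case by (simp add: denom_Suc mult.commute)
  qed simp
  then show ?thesis
    using of_nat_less_two_power[of n, where 'a=real] by linarith
qed

lemma shift: "digit_sequence (\<lambda>i. N (n + i)) (\<lambda>i. B (n + i))"
  by standard (use N_ge_2 finite_B card_B B_Ints in auto)

lemma real_distribution_finite_convolution: "real_distribution (finite_convolution N B n)"
proof (induction n)
  case 0
  show ?case
    unfolding finite_convolution.simps real_distribution_def real_distribution_axioms_def
    by (auto intro!: prob_space_return)
next
  case (Suc n)
  then show ?case
    unfolding finite_convolution.simps
    by (intro real_distribution_convolution real_distribution_uniform_discrete)
qed

lemma fourier_transform_finite_convolution:
  "fourier_transform (finite_convolution N B n) \<xi> = partial_ft N B n \<xi>"
proof (induction n)
  case 0
  show ?case
    unfolding fourier_transform_eq by (simp add: integral_return)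
next
  case (Suc n)
  have eq: "real (\<Prod>i\<le>n. N i) = denom N (Suc n)"
    unfolding denom_def lessThan_Suc_atMost by (rule of_nat_prod)
  have "finite ((\<lambda>b. b / denom N (Suc n)) ` B n)" "(\<lambda>b. b / denom N (Suc n)) ` B n \<noteq> {}"
    using finite_B B_nonempty by auto
  from fourier_transform_uniform_discrete[OF this]
  have "fourier_transform (uniform_discrete ((\<lambda>b. b / denom N (Suc n)) ` B n)) \<xi>
      = mask (B n) (\<xi> / denom N (Suc n))"
    using mask_image_divide denom_pos[of "Suc n"] by (metis less_irrefl)
  then show ?case
    unfolding finite_convolution.simps eq partial_ft_Suc Suc[symmetric]
    by (simp only: fourier_transform_convolution[OF real_distribution_finite_convolution
          real_distribution_uniform_discrete])
qed

lemma fourier_transform_infinite_convolution: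
  assumes "is_infinite_convolution N B \<mu>"
  shows "(\<lambda>n. partial_ft N B n \<xi>) \<longlonglongrightarrow> fourier_transform \<mu> \<xi>"
  unfolding fourier_transform_finite_convolution[symmetric] fourier_transform_eq_char
  using assms unfolding is_infinite_convolution_def
  by (intro levy_continuity1 real_distribution_finite_convolution) auto

text \<open>Every further factor has modulus at most 1, so the moduli of the partial products
  decrease to their limit. In particular, a zero of a partial product is a zero of the transform of
  \<mu>.\<close>

lemma norm_fourier_transform_le_partial_ft:
  assumes "is_infinite_convolution N B \<mu>"
  shows "norm (fourier_transform \<mu> \<xi>) \<le> norm (partial_ft N B n \<xi>)"
proof (rule LIMSEQ_le_const2)
  show "(\<lambda>m. norm (partial_ft N B m \<xi>)) \<longlonglongrightarrow> norm (fourier_transform \<mu> \<xi>)"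
    by (intro tendsto_norm fourier_transform_infinite_convolution assms)
  have "norm (partial_ft N B m \<xi>) \<le> norm (partial_ft N B n \<xi>)" if le: "n \<le> m" for m
  proof -
    obtain k where m: "m = n + k"
      using le_Suc_ex[OF le] by blast
    show ?thesis
      unfolding m partial_ft_add norm_mult by (rule mult_left_le[OF norm_partial_ft_le_1 norm_ge_zero])
  qed
  then show "\<exists>M. \<forall>m\<ge>M. norm (partial_ft N B m \<xi>) \<le> norm (partial_ft N B n \<xi>)"
    by blast
qed

text \<open>Split the partial product at \<open>n\<close> and let the number of remaining factors
  tend to infinity.\<close>

lemma fourier_transform_tail:
  assumes "is_infinite_convolution N B \<mu>" "is_tail_convolution N B n \<nu>"
  shows "fourier_transform \<mu> \<xi> = partial_ft N B n \<xi> * fourier_transform \<nu> (\<xi> / denom N n)"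
proof (rule LIMSEQ_unique)
  interpret tail: digit_sequence "\<lambda>i. N (n + i)" "\<lambda>i. B (n + i)"
    by (rule shift)
  show "(\<lambda>m. partial_ft N B (n + m) \<xi>) \<longlonglongrightarrow> fourier_transform \<mu> \<xi>"
    using LIMSEQ_ignore_initial_segment[OF fourier_transform_infinite_convolution[OF assms(1)], of n \<xi>]
    by (simp add: add.commute)
  show "(\<lambda>m. partial_ft N B (n + m) \<xi>) \<longlonglongrightarrow> partial_ft N B n \<xi> * fourier_transform \<nu> (\<xi> / denom N n)"
    using assms(2) unfolding partial_ft_add is_tail_convolution_def
    by (intro tendsto_intros tail.fourier_transform_infinite_convolution)
qed

lemma mask_periodic:
  assumes "m \<in> \<int>"
  shows "mask (B k) (\<xi> + m) = mask (B k) \<xi>"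
proof -
  have "wave (\<xi> + m) b = wave \<xi> b" if "b \<in> B k" for b
    using that B_Ints[of k] assms by (auto simp: wave_add_left wave_Ints Ints_mult)
  then show ?thesis by (simp add: mask_def)
qed

text \<open>Each \<open>denom N (Suc j)\<close> with \<open>j < n\<close> divides
  \<open>denom N n\<close>, so the shift becomes an integer inside every mask, and masks of integer
  digits have period 1.\<close>

lemma partial_ft_periodic:
  assumes "m \<in> \<int>"
  shows "partial_ft N B n (\<xi> + denom N n * m) = partial_ft N B n \<xi>"
  unfolding partial_ft_def
proof (intro prod.cong refl)
  fix j assume "j \<in> {..<n}"
  then have "denom N n = denom N (Suc j) * denom (\<lambda>i. N (Suc j + i)) (n - Suc j)"
    using denom_add[of N "Suc j" "n - Suc j"] by (simp only: lessThan_iff Suc_le_eq[symmetric] le_add_diff_inverse)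
  then have "(\<xi> + denom N n * m) / denom N (Suc j)
      = \<xi> / denom N (Suc j) + denom (\<lambda>i. N (Suc j + i)) (n - Suc j) * m"
    using denom_pos[of "Suc j"] by (simp add: field_simps)
  moreover have "denom (\<lambda>i. N (Suc j + i)) (n - Suc j) * m \<in> \<int>"
    using assms by (intro Ints_mult denom_Ints)
  ultimately show "mask (B j) ((\<xi> + denom N n * m) / denom N (Suc j)) = mask (B j) (\<xi> / denom N (Suc j))"
    by (simp only: mask_periodic)
qed

lemma partial_ft_zero: "partial_ft N B n 0 = 1"
  by (simp add: partial_ft_def mask_0 finite_B B_nonempty)

end

section \<open>Hadamard triples\<close>

text \<open>Expand the squared modulus into a double sum over pairs of digits. Summing over
  \<open>L\<close> first, orthogonality of the rows leaves only the diagonal, whose \<open>q\<close>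
  terms \<open>q\<close> cancel the normalisation \<open>q\<^sup>2\<close>.\<close>

lemma hadamard_triple_mask:
  assumes "hadamard_triple N B L"
  shows "(\<Sum>l\<in>L. (norm (mask B (\<xi> + l / real N)))\<^sup>2) = 1"
proof -
  define q where "q = real (card B)"
  have B: "finite B" "q > 0" and orth: "\<And>b b'. b \<in> B \<Longrightarrow> b' \<in> B \<Longrightarrow>
      (\<Sum>l\<in>L. (of_real (1 / sqrt q) * wave b (l / real N)) * cnj (of_real (1 / sqrt q) * wave b' (l / real N)))
      = of_bool (b = b')"
    using assms unfolding hadamard_triple_def unitary_matrix_on_def wave_def q_def by auto
  have orth': "(\<Sum>l\<in>L. wave (b - b') (l / real N)) = (if b = b' then of_real q else 0)"
    if "b \<in> B" "b' \<in> B" for b b'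
  proof -
    have q: "complex_of_real (1 / q) = of_real (1 / sqrt q) * cnj (of_real (1 / sqrt q))"
      using B by (simp flip: of_real_mult)
    have "(\<Sum>l\<in>L. (of_real (1 / sqrt q) * wave b (l / real N)) * cnj (of_real (1 / sqrt q) * wave b' (l / real N)))
      = of_real (1 / q) * (\<Sum>l\<in>L. wave (b - b') (l / real N))"
      unfolding sum_distrib_left wave_minus_left complex_cnj_mult q
      by (intro sum.cong refl) (simp only: mult_ac)
    with orth[OF that] B show ?thesis
      by (auto simp: field_simps split: if_splits)
  qed
  have expand: "complex_of_real ((norm (mask B (\<xi> + l / real N)))\<^sup>2)
     = (\<Sum>b\<in>B. \<Sum>b'\<in>B. wave (b - b') \<xi> * wave (b - b') (l / real N)) / of_real (q\<^sup>2)" for l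
  proof -
    have sym: "wave a x = wave x a" for a x
      by (simp add: wave_def mult.commute)
    have "complex_of_real ((norm (mask B (\<xi> + l / real N)))\<^sup>2)
      = (\<Sum>b\<in>B. wave b (\<xi> + l / real N)) * cnj (\<Sum>b\<in>B. wave b (\<xi> + l / real N)) / of_real (q\<^sup>2)"
      unfolding complex_norm_square mask_def sym[of "\<xi> + l / real N"]
      by (simp add: q_def power2_eq_square del: cnj_wave)
    also have "(\<Sum>b\<in>B. wave b (\<xi> + l / real N)) * cnj (\<Sum>b\<in>B. wave b (\<xi> + l / real N))
      = (\<Sum>b\<in>B. \<Sum>b'\<in>B. wave (b - b') (\<xi> + l / real N))"
      by (simp add: sum_product wave_minus_left del: cnj_wave)
    finally show ?thesis by (simp add: wave_add_right)
  qed
  have "complex_of_real (\<Sum>l\<in>L. (norm (mask B (\<xi> + l / real N)))\<^sup>2)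
     = (\<Sum>l\<in>L. \<Sum>b\<in>B. \<Sum>b'\<in>B. wave (b - b') \<xi> * wave (b - b') (l / real N)) / of_real (q\<^sup>2)"
    unfolding of_real_sum expand by (simp add: sum_divide_distrib)
  also have "(\<Sum>l\<in>L. \<Sum>b\<in>B. \<Sum>b'\<in>B. wave (b - b') \<xi> * wave (b - b') (l / real N))
     = (\<Sum>b\<in>B. \<Sum>b'\<in>B. \<Sum>l\<in>L. wave (b - b') \<xi> * wave (b - b') (l / real N))"
    by (subst sum.swap, rule sum.cong[OF refl], rule sum.swap)
  also have "\<dots> = (\<Sum>b\<in>B. \<Sum>b'\<in>B. if b = b' then of_real q else 0)"
    by (intro sum.cong refl) (auto simp: orth' sum_distrib_left[symmetric])
  also have "\<dots> = of_real (q\<^sup>2)"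
    using B by (simp add: q_def power2_eq_square)
  finally have "complex_of_real (\<Sum>l\<in>L. (norm (mask B (\<xi> + l / real N)))\<^sup>2) = of_real 1"
    using B by simp
  then show ?thesis unfolding of_real_eq_iff .
qed

text \<open>Translating \<open>L\<close> by \<open>c\<close> multiplies row \<open>b\<close> by the
  unimodular constant \<open>wave b (- c / real N)\<close>, which preserves unitarity.\<close>

lemma hadamard_triple_translate:
  assumes "hadamard_triple N B L" "c \<in> \<int>"
  shows "hadamard_triple N B ((\<lambda>l. l - c) ` L)"
proof -
  define U where "U b l = of_real (1 / sqrt (real (card B))) * wave b (l / real N)" for b l
  have U_eq: "U = (\<lambda>b l. of_real (1 / sqrt (real (card B))) *
      exp (- 2 * of_real pi * \<i> * of_real (b * l / real N)))"
    by (auto simp: U_def wave_def fun_eq_iff)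
  have shift: "U b (l - c) = U b l * wave b (- c / real N)" for b l
    by (simp add: U_def diff_divide_distrib flip: wave_add_right)
  have wave_cnj: "wave b x * cnj (wave b x) = 1" for b x
    by (simp flip: wave_minus_left del: cnj_wave)
  have inj: "inj_on (\<lambda>l. l - c) L" by (simp add: inj_on_def)
  have un: "unitary_matrix_on B L U"
    using assms unfolding hadamard_triple_def U_eq by blast
  have "unitary_matrix_on B ((\<lambda>l. l - c) ` L) U"
    unfolding unitary_matrix_on_def
  proof (intro conjI ballI)
    fix b b' assume b: "b \<in> B" "b' \<in> B"
    have "(\<Sum>l\<in>(\<lambda>l. l - c) ` L. U b l * cnj (U b' l))
      = (\<Sum>l\<in>L. (U b l * cnj (U b' l)) * (wave b (- c / real N) * cnj (wave b' (- c / real N))))"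
      by (simp add: sum.reindex[OF inj] shift algebra_simps del: cnj_wave)
    also have "\<dots> = of_bool (b = b') * (wave b (- c / real N) * cnj (wave b' (- c / real N)))"
      using un b unfolding unitary_matrix_on_def sum_distrib_right[symmetric] by simp
    also have "\<dots> = of_bool (b = b')"
      by (simp add: wave_cnj del: cnj_wave)
    finally show "(\<Sum>l\<in>(\<lambda>l. l - c) ` L. U b l * cnj (U b' l)) = of_bool (b = b')" .
  next
    fix j j' assume "j \<in> (\<lambda>l. l - c) ` L" "j' \<in> (\<lambda>l. l - c) ` L"
    then obtain l l' where l: "l \<in> L" "l' \<in> L" "j = l - c" "j' = l' - c" by auto
    have "cnj (U b j) * U b j' = cnj (U b l) * U b l'" for b
    proof -
      have "cnj (U b j) * U b j' = cnj (U b l) * U b l' * (wave b (- c / real N) * cnj (wave b (- c / real N)))"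
        unfolding l shift by (simp add: algebra_simps del: cnj_wave)
      then show ?thesis by (simp only: wave_cnj mult_1_right)
    qed
    then show "(\<Sum>b\<in>B. cnj (U b j) * U b j') = of_bool (j = j')"
      using un l unfolding unitary_matrix_on_def by simp
  qed (use un inj in \<open>auto simp: unitary_matrix_on_def card_image\<close>)
  then show ?thesis
    using assms unfolding hadamard_triple_def U_eq by auto
qed

text \<open>Having 0 in \<open>L\<close> is what keeps the old points when a common spectrum is
  passed to the next level.\<close>

lemma admissible_pair_obtain_hadamard:
  assumes "admissible_pair N B"
  obtains L where "hadamard_triple N B L" "0 \<in> L"
proof -
  obtain L where L: "hadamard_triple N B L"
    using assms by (auto simp: admissible_pair_def)
  then have "card L \<noteq> 0"
    by (auto simp: hadamard_triple_def unitary_matrix_on_def)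
  then obtain c where c: "c \<in> L" by fastforce
  then have "c \<in> \<int>" using L by (auto simp: hadamard_triple_def)
  with L c show ?thesis
    by (intro that[of "(\<lambda>l. l - c) ` L"] hadamard_triple_translate) auto
qed

section \<open>Construction of the spectra\<close>

lemma finite_subset_incseq_Union:
  fixes A :: "nat \<Rightarrow> 'a set"
  assumes "incseq A" "finite F" "F \<subseteq> (\<Union>m. A m)"
  obtains m where "F \<subseteq> A m"
proof -
  have "\<exists>m. F \<subseteq> A m"
    using assms(2,3)
  proof (induction F)
    case (insert x F)
    then obtain i m where "F \<subseteq> A i" "x \<in> A m" by auto
    then have "insert x F \<subseteq> A (max i m)"
      using incseqD[OF assms(1), of i "max i m"] incseqD[OF assms(1), of m "max i m"] by auto
    then show ?case ..
  qed simp
  then show ?thesis using that by blast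
qed

lemma equi_positive_convolutionE:
  assumes "equi_positive_convolution t N B \<mu>"
  obtains \<sigma> :: "nat \<Rightarrow> nat" and \<nu> \<epsilon> \<delta> where "strict_mono \<sigma>"
    "\<And>j. is_tail_convolution N B (\<sigma> j) (\<nu> j)" "0 < \<epsilon>" "0 < \<delta>"
    "\<And>x j. x \<in> {0..<real t} \<Longrightarrow> \<exists>k::int. (x = 0 \<longrightarrow> k = 0) \<and>
      (\<forall>y. \<bar>y\<bar> < \<delta> \<longrightarrow> \<epsilon> \<le> norm (fourier_transform (\<nu> j) (x + y + real t * real_of_int k)))"
proof -
  obtain \<sigma> \<nu> where \<sigma>: "strict_mono (\<sigma> :: nat \<Rightarrow> nat)" "\<forall>j. is_tail_convolution N B (\<sigma> j) (\<nu> j)"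
    and equi: "equi_positive_family t (range \<nu>)"
    using assms unfolding equi_positive_convolution_def by (elim conjE exE)
  obtain \<epsilon> \<delta> where pos: "0 < \<epsilon>" "0 < \<delta>"
    and ep: "\<forall>x\<in>{0..<real t}. \<forall>\<eta>\<in>range \<nu>. \<exists>k::int. (x = 0 \<longrightarrow> k = 0) \<and>
      (\<forall>y. \<bar>y\<bar> < \<delta> \<longrightarrow> \<epsilon> \<le> norm (fourier_transform \<eta> (x + y + real t * real_of_int k)))"
    using equi unfolding equi_positive_family_def by (elim conjE exE)
  show ?thesis
    by (rule that[OF \<sigma>(1) _ pos]) (use \<sigma>(2) bspec[OF bspec[OF ep] rangeI] in auto)
qed

text \<open>For the set \<open>E\<close> of the theorem, \<open>1 \<in> E\<close> follows from
  nonemptiness by \<open>equi_positive_convolution_1\<close>. It makes the points of a common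
  spectrum themselves orthogonal, not only their multiples.\<close>

locale admissible_sequence =
  fixes N :: "nat \<Rightarrow> nat" and B :: "nat \<Rightarrow> real set" and E :: "nat set" and \<mu> :: "real measure"
  assumes admissible: "admissible_pair (N k) (B k)"
    and eigenvalue: "t \<in> E \<Longrightarrow> admissible_eigenvalue (N k) (B k) (real t)"
    and E_pos: "t \<in> E \<Longrightarrow> 0 < t"
    and one_in_E: "1 \<in> E"
    and equi_positive: "t \<in> E \<Longrightarrow> equi_positive_convolution t N B \<mu>"
    and convolution: "is_infinite_convolution N B \<mu>"
begin

sublocale digit_sequence N B
  by standard (use admissible in \<open>auto simp: admissible_pair_def hadamard_triple_def\<close>)

sublocale real_distribution \<mu>
  using convolution by (simp add: is_infinite_convolution_def)

text \<open>Every \<open>t \<Lambda>\<close> with \<open>t \<in> E\<close> is a spectrum of the convolution of the first \<open>n\<close> factors; the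
  orthogonality is the identity below at \<open>\<xi> = - t \<lambda>\<close>.\<close>

definition finite_spectrum :: "nat \<Rightarrow> real set \<Rightarrow> bool" where
  "finite_spectrum n \<Lambda> \<longleftrightarrow> finite \<Lambda> \<and> \<Lambda> \<subseteq> \<int> \<and>
     (\<forall>t\<in>E. \<forall>\<xi>. (\<Sum>l\<in>\<Lambda>. (norm (partial_ft N B n (\<xi> + real t * l)))\<^sup>2) = 1)"

lemma finite_spectrum_orthogonal:
  assumes \<Lambda>: "finite_spectrum n \<Lambda>" and "t \<in> E" "a \<in> \<Lambda>" "b \<in> \<Lambda>" "a \<noteq> b"
  shows "partial_ft N B n (real t * (a - b)) = 0"
proof -
  let ?g = "\<lambda>l. (norm (partial_ft N B n (- real t * b + real t * l)))\<^sup>2"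
  have fin: "finite \<Lambda>" and "(\<Sum>l\<in>\<Lambda>. ?g l) = 1"
    using \<Lambda> \<open>t \<in> E\<close> unfolding finite_spectrum_def by blast+
  moreover have "?g b = 1" by (simp add: partial_ft_zero)
  ultimately have "(\<Sum>l\<in>\<Lambda> - {b}. ?g l) = 0"
    using sum.remove[OF fin \<open>b \<in> \<Lambda>\<close>, of ?g] by simp
  then have "?g a = 0"
    using fin assms sum_nonneg_eq_0_iff[of "\<Lambda> - {b}" ?g] by simp
  moreover have "- real t * b + real t * a = real t * (a - b)"
    by (simp add: algebra_simps)
  ultimately show ?thesis by simp
qed

text \<open>The points lie in distinct residue classes modulo \<open>denom N n\<close>: the partial
  product has this period and equals 1 at 0, whereas it vanishes at differences of distinct
  points.\<close>

lemma finite_spectrum_incongruent: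
  assumes "finite_spectrum n \<Lambda>" "a \<in> \<Lambda>" "b \<in> \<Lambda>" "a - b = denom N n * m" "m \<in> \<int>"
  shows "a = b"
proof (rule ccontr)
  assume "a \<noteq> b"
  then have "partial_ft N B n (0 + denom N n * m) = 0"
    using finite_spectrum_orthogonal[OF assms(1) one_in_E assms(2,3)] assms(4) by simp
  then show False
    using partial_ft_periodic[OF assms(5), of n 0] partial_ft_zero by simp
qed

lemma finite_spectrum_nonempty: "finite_spectrum n \<Lambda> \<Longrightarrow> \<Lambda> \<noteq> {}"
  using one_in_E by (auto simp: finite_spectrum_def)

lemma finite_spectrum_0: "finite_spectrum 0 {0}"
  by (simp add: finite_spectrum_def)

text \<open>As \<open>t\<close> is a natural number, \<open>real t * k l\<close> is an integer, so
  periodicity preserves every value for all \<open>t\<close> at once; incongruence keeps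
  \<open>f\<close> injective.\<close>

lemma finite_spectrum_modify:
  assumes \<Lambda>: "finite_spectrum n \<Lambda>" and f: "\<And>l. l \<in> \<Lambda> \<Longrightarrow> f l = l + denom N n * k l" "\<And>l. l \<in> \<Lambda> \<Longrightarrow> k l \<in> \<int>"
  shows "finite_spectrum n (f ` \<Lambda>)"
proof -
  have inj: "inj_on f \<Lambda>"
  proof (rule inj_onI)
    fix a b assume ab: "a \<in> \<Lambda>" "b \<in> \<Lambda>" "f a = f b"
    then have "a - b = denom N n * (k b - k a)"
      using f by (simp add: algebra_simps)
    then show "a = b"
      using finite_spectrum_incongruent[OF \<Lambda> ab(1,2)] f(2) ab Ints_diff by blast
  qed
  have "partial_ft N B n (\<xi> + real t * f l) = partial_ft N B n (\<xi> + real t * l)" if "l \<in> \<Lambda>" for \<xi> t l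
    using partial_ft_periodic[of "real t * k l" n "\<xi> + real t * l"] f[OF that] by (simp add: algebra_simps)
  moreover have "f l \<in> \<int>" if "l \<in> \<Lambda>" for l
    using \<Lambda> f[OF that] that by (auto simp: finite_spectrum_def denom_Ints)
  ultimately show ?thesis
    using \<Lambda> unfolding finite_spectrum_def by (auto simp: sum.reindex[OF inj])
qed

text \<open>The new set is \<open>\<Lambda> + denom N n * L\<close>. Periodicity removes
  \<open>l\<close> from the first \<open>n\<close> masks, and the sum over \<open>l\<close> for the
  last mask is 1 because \<open>t L\<close> again gives a Hadamard triple. Thus one \<open>L\<close>
  serves all \<open>t \<in> E\<close>.\<close>

lemma finite_spectrum_Suc:
  assumes \<Lambda>: "finite_spectrum n \<Lambda>"
  obtains \<Lambda>' where "finite_spectrum (Suc n) \<Lambda>'" "\<Lambda> \<subset> \<Lambda>'"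
proof -
  obtain L where L: "hadamard_triple (N n) (B n) L" and "0 \<in> L"
    using admissible_pair_obtain_hadamard[OF admissible] .
  have LI: "L \<subseteq> \<int>" and finL: "finite L" and "2 \<le> card L"
    using L by (auto simp: hadamard_triple_def unitary_matrix_on_def)
  then have "card (L - {0}) \<noteq> 0"
    using \<open>0 \<in> L\<close> by (simp add: card_Diff_singleton)
  then obtain l1 where "l1 \<in> L - {0}"
    by (metis all_not_in_conv card.empty)
  then have l1: "l1 \<in> L" "l1 \<noteq> 0" by auto
  define g where "g = (\<lambda>(a, l). a + denom N n * l)"
  have inj: "inj_on g (\<Lambda> \<times> L)"
  proof (rule inj_onI)
    fix p q assume pq: "p \<in> \<Lambda> \<times> L" "q \<in> \<Lambda> \<times> L" "g p = g q"
    then have diff: "fst p - fst q = denom N n * (snd q - snd p)"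
      by (auto simp: g_def algebra_simps)
    have "fst p = fst q"
      by (rule finite_spectrum_incongruent[OF \<Lambda> _ _ diff]) (use pq LI in \<open>auto intro!: Ints_diff\<close>)
    with diff denom_pos[of n] show "p = q" by (auto simp: prod_eq_iff)
  qed
  have one: "(\<Sum>a\<in>g ` (\<Lambda> \<times> L). (norm (partial_ft N B (Suc n) (\<xi> + real t * a)))\<^sup>2) = 1"
    if "t \<in> E" for t \<xi>
  proof -
    have tL: "hadamard_triple (N n) (B n) ((*) (real t) ` L)"
      using eigenvalue[OF that] L by (auto simp: admissible_eigenvalue_def)
    have injt: "inj_on ((*) (real t)) L"
      using E_pos[OF that] by (auto simp: inj_on_def)
    have factor: "partial_ft N B (Suc n) (\<xi> + real t * g (a, l))
        = partial_ft N B n (\<xi> + real t * a) *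
          mask (B n) ((\<xi> + real t * a) / denom N (Suc n) + real t * l / real (N n))" if "l \<in> L" for a l
    proof -
      have "\<xi> + real t * g (a, l) = (\<xi> + real t * a) + denom N n * (real t * l)"
        by (simp add: g_def algebra_simps)
      moreover have "real t * l \<in> \<int>" using that LI by auto
      moreover have "((\<xi> + real t * a) + denom N n * (real t * l)) / denom N (Suc n)
          = (\<xi> + real t * a) / denom N (Suc n) + real t * l / real (N n)"
        using denom_pos[of n] N_ge_2[of n] by (simp add: denom_Suc add_divide_distrib)
      ultimately show ?thesis
        by (simp only: partial_ft_Suc partial_ft_periodic)
    qed
    have "(\<Sum>a\<in>g ` (\<Lambda> \<times> L). (norm (partial_ft N B (Suc n) (\<xi> + real t * a)))\<^sup>2)
      = (\<Sum>a\<in>\<Lambda>. \<Sum>l\<in>L. (norm (partial_ft N B (Suc n) (\<xi> + real t * g (a, l))))\<^sup>2)"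
      by (simp add: sum.reindex[OF inj] sum.cartesian_product)
    also have "\<dots> = (\<Sum>a\<in>\<Lambda>. (norm (partial_ft N B n (\<xi> + real t * a)))\<^sup>2 *
        (\<Sum>l\<in>L. (norm (mask (B n) ((\<xi> + real t * a) / denom N (Suc n) + real t * l / real (N n))))\<^sup>2))"
      by (simp add: factor norm_mult power_mult_distrib sum_distrib_left)
    also have "\<dots> = (\<Sum>a\<in>\<Lambda>. (norm (partial_ft N B n (\<xi> + real t * a)))\<^sup>2)"
      using hadamard_triple_mask[OF tL] by (simp add: sum.reindex[OF injt])
    also have "\<dots> = 1"
      using \<Lambda> that by (simp add: finite_spectrum_def)
    finally show ?thesis .
  qed
  have "g ` (\<Lambda> \<times> L) \<subseteq> \<int>"
    using \<Lambda> LI by (force simp: finite_spectrum_def g_def denom_Ints)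
  then have spec: "finite_spectrum (Suc n) (g ` (\<Lambda> \<times> L))"
    using \<Lambda> finL one by (simp add: finite_spectrum_def)
  have sub: "\<Lambda> \<subseteq> g ` (\<Lambda> \<times> L)"
    using \<open>0 \<in> L\<close> by (force simp: g_def image_iff)
  obtain a where a: "a \<in> \<Lambda>"
    using finite_spectrum_nonempty[OF \<Lambda>] by auto
  \<comment> \<open>Strictness of the inclusion: this point is congruent to \<open>a\<close> but
    different from it.\<close>
  have "g (a, l1) \<notin> \<Lambda>"
  proof
    assume "g (a, l1) \<in> \<Lambda>"
    then have "g (a, l1) = a"
      by (rule finite_spectrum_incongruent[OF \<Lambda> _ a, where m=l1]) (use l1 LI in \<open>auto simp: g_def\<close>)
    then show False
      using denom_pos[of n] l1 by (simp add: g_def)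
  qed
  moreover have "g (a, l1) \<in> g ` (\<Lambda> \<times> L)" using a l1 by auto
  ultimately show ?thesis using that[OF spec] sub by blast
qed

lemma finite_spectrum_extend:
  assumes "finite_spectrum n \<Lambda>" "n < n'"
  obtains \<Lambda>' where "finite_spectrum n' \<Lambda>'" "\<Lambda> \<subset> \<Lambda>'"
proof -
  have "\<exists>\<Lambda>'. finite_spectrum n' \<Lambda>' \<and> \<Lambda> \<subset> \<Lambda>'"
    using Suc_leI[OF \<open>n < n'\<close>]
  proof (induction n' rule: dec_induct)
    case base
    show ?case using finite_spectrum_Suc[OF assms(1)] by blast
  next
    case (step m)
    then show ?case using finite_spectrum_Suc by (metis psubset_trans)
  qed
  then show ?thesis using that by blast
qed

text \<open>The strict inclusion in \<open>finite_spectrum_extend\<close> supplies a new point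
  \<open>a\<close>. Moving only \<open>a\<close> leaves the old points in place, so both versions
  extend \<open>\<Lambda>\<close>.\<close>

lemma finite_spectrum_branch:
  assumes \<Lambda>: "finite_spectrum n \<Lambda>" and "n < n'" "\<kappa> \<in> \<int>"
  obtains \<Lambda>1 \<Lambda>2 a where "finite_spectrum n' \<Lambda>1" "finite_spectrum n' \<Lambda>2"
    "\<Lambda> \<subseteq> \<Lambda>1" "\<Lambda> \<subseteq> \<Lambda>2" "a \<in> \<Lambda>1" "a + denom N n' * \<kappa> \<in> \<Lambda>2"
proof -
  obtain \<Lambda>1 where \<Lambda>1: "finite_spectrum n' \<Lambda>1" "\<Lambda> \<subset> \<Lambda>1"
    using finite_spectrum_extend[OF \<Lambda> \<open>n < n'\<close>] .
  then obtain a where a: "a \<in> \<Lambda>1" "a \<notin> \<Lambda>" by auto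
  define k where "k l = (if l = a then \<kappa> else 0)" for l
  define f where "f l = l + denom N n' * k l" for l
  have "finite_spectrum n' (f ` \<Lambda>1)"
    by (rule finite_spectrum_modify[OF \<Lambda>1(1), of f k]) (use assms in \<open>auto simp: f_def k_def\<close>)
  moreover have "\<Lambda> \<subseteq> f ` \<Lambda>1"
  proof
    fix l assume "l \<in> \<Lambda>"
    then have "f l = l" "l \<in> \<Lambda>1" using a \<Lambda>1 by (auto simp: f_def k_def)
    then show "l \<in> f ` \<Lambda>1" by (metis imageI)
  qed
  moreover have "a + denom N n' * \<kappa> \<in> f ` \<Lambda>1"
    using a by (auto simp: f_def k_def intro!: image_eqI[of _ _ a])
  ultimately show ?thesis
    using that \<Lambda>1 a(1) by blast
qed

text \<open>If one common spectrum, at whatever level, contained both points, the transform of \<mu>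
  would vanish at \<open>denom N n * \<kappa>\<close>. But there the partial product is 1, so its
  value is that of the transform of \<open>\<nu>\<close> at \<open>\<kappa>\<close>.\<close>

lemma finite_spectrum_tail_nonzero:
  assumes \<nu>: "is_tail_convolution N B n \<nu>" and \<kappa>: "\<kappa> \<in> \<int>" "\<kappa> \<noteq> 0" "fourier_transform \<nu> \<kappa> \<noteq> 0"
    and \<Lambda>: "finite_spectrum m \<Lambda>" "a \<in> \<Lambda>"
  shows "a + denom N n * \<kappa> \<notin> \<Lambda>"
proof
  assume b: "a + denom N n * \<kappa> \<in> \<Lambda>"
  have "denom N n * \<kappa> \<noteq> 0"
    using denom_pos[of n] \<kappa> by simp
  then have "partial_ft N B m (denom N n * \<kappa>) = 0"
    using finite_spectrum_orthogonal[OF \<Lambda>(1) one_in_E b \<Lambda>(2)] by simp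
  then have "fourier_transform \<mu> (denom N n * \<kappa>) = 0"
    using norm_fourier_transform_le_partial_ft[OF convolution, of "denom N n * \<kappa>" m] by simp
  moreover have "partial_ft N B n (denom N n * \<kappa>) = 1"
    using partial_ft_periodic[OF \<kappa>(1), of n 0] by (simp add: partial_ft_zero)
  ultimately show False
    using fourier_transform_tail[OF convolution \<nu>, of "denom N n * \<kappa>"] denom_pos[of n] \<kappa> by simp
qed

text \<open>For \<open>s > 1\<close> the equi-positivity at \<open>x = 1\<close> yields an integer \<open>\<kappa> \<equiv> 1 (mod s)\<close>, hence nonzero,
  at which the Fourier transform of a tail does not vanish. Moving a new point by the corresponding
  multiple of the denominator cannot be undone later, since the old and the new position are not
  orthogonal.\<close>

lemma finite_spectrum_split:
  assumes "s \<in> E" "1 < s" and \<Lambda>: "finite_spectrum n \<Lambda>"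
  obtains n' \<Lambda>1 \<Lambda>2 where "n < n'" "finite_spectrum n' \<Lambda>1" "finite_spectrum n' \<Lambda>2"
    "\<Lambda> \<subseteq> \<Lambda>1" "\<Lambda> \<subseteq> \<Lambda>2" "\<And>m \<Theta>. finite_spectrum m \<Theta> \<Longrightarrow> \<not> \<Lambda>1 \<union> \<Lambda>2 \<subseteq> \<Theta>"
proof -
  obtain \<sigma> :: "nat \<Rightarrow> nat" and \<nu> \<epsilon> \<delta> where \<sigma>: "strict_mono \<sigma>"
    and \<nu>: "\<And>j. is_tail_convolution N B (\<sigma> j) (\<nu> j)" and pos: "0 < \<epsilon>" "0 < \<delta>"
    and ep: "\<And>x j. x \<in> {0..<real s} \<Longrightarrow> \<exists>k::int. (x = 0 \<longrightarrow> k = 0) \<and>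
      (\<forall>y. \<bar>y\<bar> < \<delta> \<longrightarrow> \<epsilon> \<le> norm (fourier_transform (\<nu> j) (x + y + real s * real_of_int k)))"
    by (rule equi_positive_convolutionE[OF equi_positive[OF \<open>s \<in> E\<close>]]) (rule that)
  \<comment> \<open>The index \<open>Suc n\<close> makes the level \<open>\<sigma> (Suc n)\<close>
    exceed \<open>n\<close>.\<close>
  from ep[of 1 "Suc n"] obtain k :: int where
    "\<forall>y. \<bar>y\<bar> < \<delta> \<longrightarrow> \<epsilon> \<le> norm (fourier_transform (\<nu> (Suc n)) (1 + y + real s * real_of_int k))"
    using \<open>1 < s\<close> by auto
  from this[rule_format, of 0] have ge: "\<epsilon> \<le> norm (fourier_transform (\<nu> (Suc n)) (1 + real s * real_of_int k))"
    using pos by simp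
  define \<kappa> where "\<kappa> = 1 + real s * real_of_int k"
  have "\<not> int s dvd 1"
    using \<open>1 < s\<close> by simp
  moreover have "int s dvd 1" if "1 + int s * k = 0"
    using that by (intro dvdI[of _ _ "- k"]) simp
  ultimately have "1 + int s * k \<noteq> 0" by blast
  moreover have \<kappa>_int: "\<kappa> = real_of_int (1 + int s * k)"
    by (simp add: \<kappa>_def)
  ultimately have \<kappa>: "\<kappa> \<in> \<int>" "\<kappa> \<noteq> 0"
    by (simp_all only: of_int_eq_0_iff Ints_of_int not_False_eq_True)
  have \<kappa>_nz: "fourier_transform (\<nu> (Suc n)) \<kappa> \<noteq> 0"
    using ge pos unfolding \<kappa>_def by auto
  have "n < \<sigma> (Suc n)"
    using strict_mono_imp_increasing[OF \<sigma>, of "Suc n"] by simp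
  moreover obtain \<Lambda>1 \<Lambda>2 a where "finite_spectrum (\<sigma> (Suc n)) \<Lambda>1" "finite_spectrum (\<sigma> (Suc n)) \<Lambda>2"
    "\<Lambda> \<subseteq> \<Lambda>1" "\<Lambda> \<subseteq> \<Lambda>2" and a: "a \<in> \<Lambda>1" "a + denom N (\<sigma> (Suc n)) * \<kappa> \<in> \<Lambda>2"
    using finite_spectrum_branch[OF \<Lambda> \<open>n < \<sigma> (Suc n)\<close> \<kappa>(1)] .
  moreover have "\<not> \<Lambda>1 \<union> \<Lambda>2 \<subseteq> \<Theta>" if "finite_spectrum m \<Theta>" for m \<Theta>
    using finite_spectrum_tail_nonzero[OF \<nu> \<kappa> \<kappa>_nz that] a by blast
  ultimately show ?thesis
    using that by blast
qed

section \<open>Domination and passage to the limit\<close>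

text \<open>A converse to \<open>norm_fourier_transform_le_partial_ft\<close> up to the factor
  \<epsilon>, on a window of radius \<open>r\<close>. The radius grows with the stage, so that every
  \<open>\<xi>\<close> is eventually covered.\<close>

definition dominated :: "nat \<Rightarrow> real \<Rightarrow> nat \<Rightarrow> nat \<Rightarrow> real set \<Rightarrow> bool" where
  "dominated t \<epsilon> r n \<Lambda> \<longleftrightarrow> (\<forall>l\<in>\<Lambda>. \<forall>\<xi>. \<bar>\<xi>\<bar> \<le> real r \<longrightarrow>
     \<epsilon> * norm (partial_ft N B n (\<xi> + real t * l)) \<le> norm (fourier_transform \<mu> (\<xi> + real t * l)))"

text \<open>By \<open>fourier_transform_tail\<close> it suffices to bound the tail below at
  \<open>(\<xi> + t l) / P\<close>. For old points this argument is near 0 when \<open>P\<close> is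
  large; new points are moved to where equi-positivity applies. The constant is fixed before
  \<open>n\<close>, \<open>\<Lambda>\<close> and \<open>m\<close>, so it is the same at all stages
  serving \<open>t\<close>.\<close>

lemma finite_spectrum_dominated_extension:
  assumes "t \<in> E"
  obtains \<epsilon> where "0 < \<epsilon>" "\<And>n \<Lambda> m. finite_spectrum n \<Lambda> \<Longrightarrow>
    \<exists>n' \<Lambda>'. n < n' \<and> finite_spectrum n' \<Lambda>' \<and> \<Lambda> \<subseteq> \<Lambda>' \<and> dominated t \<epsilon> m n' \<Lambda>'"
proof -
  obtain \<sigma> :: "nat \<Rightarrow> nat" and \<nu> \<epsilon> \<delta> where \<sigma>: "strict_mono \<sigma>"
    and \<nu>: "\<And>j. is_tail_convolution N B (\<sigma> j) (\<nu> j)" and pos: "0 < \<epsilon>" "0 < \<delta>"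
    and ep: "\<And>x j. x \<in> {0..<real t} \<Longrightarrow> \<exists>k::int. (x = 0 \<longrightarrow> k = 0) \<and>
      (\<forall>y. \<bar>y\<bar> < \<delta> \<longrightarrow> \<epsilon> \<le> norm (fourier_transform (\<nu> j) (x + y + real t * real_of_int k)))"
    by (rule equi_positive_convolutionE[OF equi_positive[OF \<open>t \<in> E\<close>]]) (rule that)
  have t: "0 < real t" using E_pos[OF \<open>t \<in> E\<close>] by simp
  show ?thesis
  proof (rule that[OF pos(1)])
    fix n \<Lambda> m assume \<Lambda>: "finite_spectrum n \<Lambda>"
    then have "finite ((\<lambda>l. \<bar>real t * l\<bar>) ` \<Lambda>)"
      by (simp add: finite_spectrum_def)
    then obtain K where K: "\<And>l. l \<in> \<Lambda> \<Longrightarrow> \<bar>real t * l\<bar> \<le> K"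
      by (meson Max_ge imageI)
    \<comment> \<open>Half of \<open>\<delta>\<close> is reserved for the old points
      \<open>t l / P\<close>, the other half for the window \<open>\<xi> / P\<close>.\<close>
    obtain i :: nat where i: "max (2 * K / \<delta>) (2 * real m / \<delta>) < real i"
      using reals_Archimedean2 by blast
    define j where "j = max (Suc n) i"
    define P where "P = denom N (\<sigma> j)"
    have "j \<le> \<sigma> j"
      by (rule strict_mono_imp_increasing[OF \<sigma>])
    then have "n < \<sigma> j" and "real i \<le> P"
      using denom_ge[of "\<sigma> j"] by (auto simp: j_def P_def)
    then have "2 * K / \<delta> < P" "2 * real m / \<delta> < P" "0 < P"
      using i denom_pos[of "\<sigma> j"] by (auto simp: P_def)
    then have P: "K / P < \<delta> / 2" "real m / P < \<delta> / 2" "0 < P"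
      using pos(2) by (simp_all add: field_simps)
    obtain \<Lambda>0 where \<Lambda>0: "finite_spectrum (\<sigma> j) \<Lambda>0" "\<Lambda> \<subset> \<Lambda>0"
      using finite_spectrum_extend[OF \<Lambda> \<open>n < \<sigma> j\<close>] .
    have "\<exists>k::int. (l \<in> \<Lambda> \<longrightarrow> k = 0) \<and> (\<forall>y. \<bar>y\<bar> < \<delta> / 2 \<longrightarrow>
        \<epsilon> \<le> norm (fourier_transform (\<nu> j) (real t * (l + P * of_int k) / P + y)))" for l
    proof (cases "l \<in> \<Lambda>")
      case True
      \<comment> \<open>The clause forcing \<open>k = 0\<close> at \<open>x = 0\<close> is what lets
        the old points stay in place.\<close>
      have near0: "\<epsilon> \<le> norm (fourier_transform (\<nu> j) y)" if "\<bar>y\<bar> < \<delta>" for y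
        using ep[of 0 j] t that by auto
      have "\<bar>real t * l / P\<bar> \<le> K / P"
        using K[OF True] P by (simp add: abs_divide divide_right_mono)
      then have "\<bar>real t * l / P\<bar> < \<delta> / 2"
        using P(1) by (rule le_less_trans)
      then have "\<bar>real t * l / P + y\<bar> < \<delta> / 2 + \<delta> / 2" if "\<bar>y\<bar> < \<delta> / 2" for y
        using that by (rule le_less_trans[OF abs_triangle_ineq add_strict_mono])
      then have "\<bar>real t * l / P + y\<bar> < \<delta>" if "\<bar>y\<bar> < \<delta> / 2" for y
        using that by simp
      then show ?thesis
        using near0 by (intro exI[of _ 0]) simp
    next
      case False
      \<comment> \<open>Reduce \<open>t l / P\<close> modulo \<open>t\<close> to \<open>x\<close>.
        The move by \<open>k - q\<close> cancels the integer part and adds the shift that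
        equi-positivity gives for \<open>x\<close>.\<close>
      define q where "q = \<lfloor>l / P\<rfloor>"
      define x where "x = real t * (l / P - of_int q)"
      have "0 \<le> l / P - of_int q" "l / P - of_int q < 1"
        unfolding q_def by linarith+
      then have "x \<in> {0..<real t}"
        unfolding x_def using t by simp
      then obtain k :: int where
        k: "\<And>y. \<bar>y\<bar> < \<delta> \<Longrightarrow> \<epsilon> \<le> norm (fourier_transform (\<nu> j) (x + y + real t * of_int k))"
        using ep[of x j] by blast
      have shift: "real t * (l + P * of_int (k - q)) / P + y = x + y + real t * of_int k" for y
        using P(3) by (simp add: x_def field_simps)
      show ?thesis
        by (intro exI[of _ "k - q"], unfold shift) (use k False pos(2) in auto)
    qed
    then obtain k where k0: "\<And>l. l \<in> \<Lambda> \<Longrightarrow> k l = (0::int)" and k: "\<And>l y. \<bar>y\<bar> < \<delta> / 2 \<Longrightarrow>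
        \<epsilon> \<le> norm (fourier_transform (\<nu> j) (real t * (l + P * of_int (k l)) / P + y))"
      by metis
    define f where "f l = l + P * of_int (k l)" for l
    have "finite_spectrum (\<sigma> j) (f ` \<Lambda>0)"
      by (rule finite_spectrum_modify[OF \<Lambda>0(1), of f "\<lambda>l. of_int (k l)"]) (auto simp: f_def P_def)
    moreover have "\<Lambda> \<subseteq> f ` \<Lambda>0"
    proof
      fix l assume "l \<in> \<Lambda>"
      then have "f l = l" "l \<in> \<Lambda>0" using k0 \<Lambda>0 by (auto simp: f_def)
      then show "l \<in> f ` \<Lambda>0" by (metis imageI)
    qed
    moreover have "\<epsilon> * norm (partial_ft N B (\<sigma> j) (\<xi> + real t * l)) \<le> norm (fourier_transform \<mu> (\<xi> + real t * l))"
      if l: "l \<in> f ` \<Lambda>0" and \<xi>: "\<bar>\<xi>\<bar> \<le> real m" for l \<xi>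
    proof -
      obtain l0 where l0: "l = f l0" using l by auto
      have "\<bar>\<xi> / P\<bar> \<le> real m / P"
        using \<xi> P by (simp add: abs_divide divide_right_mono)
      from k[OF le_less_trans[OF this P(2)], of l0]
      have "\<epsilon> \<le> norm (fourier_transform (\<nu> j) (real t * l / P + \<xi> / P))"
        unfolding l0 f_def .
      also have "real t * l / P + \<xi> / P = (\<xi> + real t * l) / denom N (\<sigma> j)"
        by (simp add: P_def add_divide_distrib)
      finally show ?thesis
        unfolding fourier_transform_tail[OF convolution \<nu>, of _ j] norm_mult
        by (subst mult.commute) (rule mult_left_mono, auto)
    qed
    ultimately show "\<exists>n' \<Lambda>'. n < n' \<and> finite_spectrum n' \<Lambda>' \<and> \<Lambda> \<subseteq> \<Lambda>' \<and> dominated t \<epsilon> m n' \<Lambda>'"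
      using \<open>n < \<sigma> j\<close> unfolding dominated_def by blast
  qed
qed

text \<open>Choose a finite \<open>F\<close> that almost exhausts the sum of the squared moduli of
  the transform of \<mu>. Domination makes the remainder small for the partial products too, so
  their sum over \<open>F\<close> is nearly 1 infinitely often, and on the fixed set
  \<open>F\<close> the limit may be taken. In \<open>dom\<close>, \<open>m0\<close> is both a lower
  bound for the stage and the radius of the window.\<close>

lemma is_spectrum_Union:
  assumes \<Lambda>: "\<And>m. finite_spectrum (n m) (\<Lambda> m)" and n: "strict_mono n" and "incseq \<Lambda>"
    and "t \<in> E" "0 < \<epsilon>"
    and dom: "\<And>m0. \<exists>m\<ge>m0. dominated t \<epsilon> m0 (n m) (\<Lambda> m)"
  shows "is_spectrum \<mu> ((*) (real t) ` (\<Union>m. \<Lambda> m))"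
proof (rule is_spectrumI)
  have fin: "finite (\<Lambda> m)" for m
    using \<Lambda>[of m] by (simp add: finite_spectrum_def)
  then show "countable ((*) (real t) ` (\<Union>m. \<Lambda> m))"
    by (intro countable_image countable_UN) (auto simp: countable_finite)
  have t: "0 < real t" using E_pos[OF \<open>t \<in> E\<close>] by simp
  show "fourier_transform \<mu> (a - b) = 0"
    if ab: "a \<in> (*) (real t) ` (\<Union>m. \<Lambda> m)" "b \<in> (*) (real t) ` (\<Union>m. \<Lambda> m)" "a \<noteq> b" for a b
  proof -
    obtain x y where xy: "a = real t * x" "b = real t * y" "x \<in> (\<Union>m. \<Lambda> m)" "y \<in> (\<Union>m. \<Lambda> m)" "x \<noteq> y"
      using ab by auto
    then obtain m where "{x, y} \<subseteq> \<Lambda> m"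
      using finite_subset_incseq_Union[OF \<open>incseq \<Lambda>\<close>, of "{x, y}"] by auto
    then have "partial_ft N B (n m) (a - b) = 0"
      using finite_spectrum_orthogonal[OF \<Lambda> \<open>t \<in> E\<close>, of x m y] xy by (simp add: right_diff_distrib)
    then show ?thesis
      using norm_fourier_transform_le_partial_ft[OF convolution, of "a - b" "n m"] by simp
  qed
  fix \<xi> \<eta> :: real assume \<eta>: "0 < \<eta>"
  define g where "g l = (norm (fourier_transform \<mu> (\<xi> + real t * l)))\<^sup>2" for l
  define p where "p m l = (norm (partial_ft N B (n m) (\<xi> + real t * l)))\<^sup>2" for m l
  have p1: "(\<Sum>l\<in>\<Lambda> m. p m l) = 1" for m
    using \<Lambda>[of m] \<open>t \<in> E\<close> by (auto simp: finite_spectrum_def p_def)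
  have g_le: "g l \<le> p m l" for m l
    unfolding g_def p_def
    by (intro power_mono norm_fourier_transform_le_partial_ft convolution) auto
  define V where "V = (\<lambda>F. \<Sum>l\<in>F. g l) ` {F. finite F \<and> F \<subseteq> (\<Union>m. \<Lambda> m)}"
  have bessel: "(\<Sum>l\<in>F. g l) \<le> 1" if F: "finite F" "F \<subseteq> (\<Union>m. \<Lambda> m)" for F
  proof -
    obtain m where m: "F \<subseteq> \<Lambda> m"
      using finite_subset_incseq_Union[OF \<open>incseq \<Lambda>\<close> F] .
    have "(\<Sum>l\<in>F. g l) \<le> (\<Sum>l\<in>\<Lambda> m. g l)"
      by (rule sum_mono2[OF fin m]) (simp add: g_def)
    also have "\<dots> \<le> (\<Sum>l\<in>\<Lambda> m. p m l)"
      by (intro sum_mono g_le)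
    finally show ?thesis by (simp add: p1)
  qed
  then have bdd: "bdd_above V" by (auto simp: V_def intro!: bdd_aboveI[of _ 1])
  have "V \<noteq> {}" by (auto simp: V_def)
  \<comment> \<open>The factor \<open>\<epsilon>\<^sup>2\<close> anticipates the loss in the squared
    domination.\<close>
  moreover have "Sup V - \<epsilon>\<^sup>2 * (\<eta> / 2) < Sup V"
    using \<eta> \<open>0 < \<epsilon>\<close> by simp
  ultimately obtain v where "v \<in> V" "Sup V - \<epsilon>\<^sup>2 * (\<eta> / 2) < v"
    using less_cSup_iff[OF _ bdd] by blast
  then obtain F where F: "finite F" "F \<subseteq> (\<Union>m. \<Lambda> m)" and FV: "Sup V - \<epsilon>\<^sup>2 * (\<eta> / 2) < (\<Sum>l\<in>F. g l)"
    by (auto simp: V_def)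
  obtain m1 where m1: "F \<subseteq> \<Lambda> m1"
    using finite_subset_incseq_Union[OF \<open>incseq \<Lambda>\<close> F] .
  obtain m2 where m2: "\<bar>\<xi>\<bar> \<le> real m2"
    using real_arch_simple by blast
  have often: "\<exists>m\<ge>m0. 1 - \<eta> / 2 < (\<Sum>l\<in>F. p m l)" for m0
  proof -
    \<comment> \<open>The maximum secures a stage beyond \<open>m0\<close>, a level containing
      \<open>F\<close> and a window containing \<open>\<xi>\<close>.\<close>
    obtain m where m: "max m0 (max m1 m2) \<le> m" and "dominated t \<epsilon> (max m0 (max m1 m2)) (n m) (\<Lambda> m)"
      using dom by blast
    then have dm: "\<And>l \<xi>. l \<in> \<Lambda> m \<Longrightarrow> \<bar>\<xi>\<bar> \<le> real (max m0 (max m1 m2)) \<Longrightarrow>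
        \<epsilon> * norm (partial_ft N B (n m) (\<xi> + real t * l)) \<le> norm (fourier_transform \<mu> (\<xi> + real t * l))"
      unfolding dominated_def by blast
    have Fm: "F \<subseteq> \<Lambda> m"
      using m m1 incseqD[OF \<open>incseq \<Lambda>\<close>, of m1 m] by auto
    have "\<epsilon>\<^sup>2 * p m l \<le> g l" if "l \<in> \<Lambda> m" for l
    proof -
      have "(\<epsilon> * norm (partial_ft N B (n m) (\<xi> + real t * l)))\<^sup>2 \<le> g l"
        unfolding g_def using m m2 \<open>0 < \<epsilon>\<close> by (intro power_mono dm that) auto
      then show ?thesis by (simp add: p_def power_mult_distrib)
    qed
    then have "\<epsilon>\<^sup>2 * (\<Sum>l\<in>\<Lambda> m - F. p m l) \<le> (\<Sum>l\<in>\<Lambda> m - F. g l)"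
      unfolding sum_distrib_left by (intro sum_mono) auto
    also have "\<dots> = (\<Sum>l\<in>\<Lambda> m. g l) - (\<Sum>l\<in>F. g l)"
      by (rule sum_diff[OF fin Fm])
    also have "\<dots> \<le> Sup V - (\<Sum>l\<in>F. g l)"
      using fin[of m] by (intro diff_right_mono cSup_upper bdd) (auto simp: V_def)
    also have "\<dots> < \<epsilon>\<^sup>2 * (\<eta> / 2)"
      using FV by simp
    finally have "(\<Sum>l\<in>\<Lambda> m - F. p m l) < \<eta> / 2"
      using \<open>0 < \<epsilon>\<close> by (simp only: mult_less_cancel_left_pos zero_less_power)
    moreover have "(\<Sum>l\<in>\<Lambda> m - F. p m l) = 1 - (\<Sum>l\<in>F. p m l)"
      using sum_diff[OF fin Fm, of "p m"] p1 by simp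
    ultimately have "1 - \<eta> / 2 < (\<Sum>l\<in>F. p m l)" by linarith
    with m show ?thesis by (intro exI[of _ m]) simp
  qed
  have "(\<lambda>m. partial_ft N B (n m) (\<xi> + real t * l)) \<longlonglongrightarrow> fourier_transform \<mu> (\<xi> + real t * l)" for l
    using LIMSEQ_subseq_LIMSEQ[OF fourier_transform_infinite_convolution[OF convolution] n]
    by (simp add: comp_def)
  then have lim: "(\<lambda>m. \<Sum>l\<in>F. p m l) \<longlonglongrightarrow> (\<Sum>l\<in>F. g l)"
    unfolding p_def g_def by (intro tendsto_intros)
  have "1 - \<eta> / 2 \<le> (\<Sum>l\<in>F. g l)"
  proof (rule ccontr)
    assume "\<not> 1 - \<eta> / 2 \<le> (\<Sum>l\<in>F. g l)"
    then have "eventually (\<lambda>m. (\<Sum>l\<in>F. p m l) < 1 - \<eta> / 2) sequentially"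
      using order_tendstoD(2)[OF lim] by simp
    then show False
      using often unfolding eventually_sequentially by (meson less_asym)
  qed
  then have "1 - \<eta> < (\<Sum>l\<in>F. g l)" using \<eta> by linarith
  moreover have "(\<Sum>l\<in>F. g l) = (\<Sum>i\<in>(*) (real t) ` F. (norm (fourier_transform \<mu> (\<xi> + i)))\<^sup>2)"
    using t by (subst sum.reindex) (auto simp: inj_on_def g_def)
  ultimately show "\<exists>F. finite F \<and> F \<subseteq> (*) (real t) ` (\<Union>m. \<Lambda> m) \<and>
      1 - \<eta> < (\<Sum>i\<in>F. (norm (fourier_transform \<mu> (\<xi> + i)))\<^sup>2)"
    using F by (intro exI[of _ "(*) (real t) ` F"]) auto
qed

section \<open>The binary tree of common spectra\<close>

text \<open>A state is a level with a common spectrum, and a binary sequence selects one of two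
  successors at each stage. If no element of \<open>E\<close> exceeds 1, the two successors need not
  differ, and the same construction still gives spectra.\<close>

theorem spectra_family:
  obtains \<Lambda> :: "(nat \<Rightarrow> bool) \<Rightarrow> real set" where
    "\<And>\<omega>. \<Lambda> \<omega> \<subseteq> \<int>" "\<And>\<omega> t. t \<in> E \<Longrightarrow> is_spectrum \<mu> ((*) (real t) ` \<Lambda> \<omega>)"
    "\<exists>s\<in>E. 1 < s \<Longrightarrow> inj \<Lambda>"
proof -
  have "\<exists>\<epsilon>. 0 < \<epsilon> \<and> (\<forall>n \<Lambda> m. finite_spectrum n \<Lambda> \<longrightarrow>
    (\<exists>n' \<Lambda>'. n < n' \<and> finite_spectrum n' \<Lambda>' \<and> \<Lambda> \<subseteq> \<Lambda>' \<and> dominated t \<epsilon> m n' \<Lambda>'))"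
    if "t \<in> E" for t
    by (rule finite_spectrum_dominated_extension[OF that]) blast
  then obtain eps where eps: "\<And>t. t \<in> E \<Longrightarrow> 0 < eps t" and ext: "\<And>t n \<Lambda> m. t \<in> E \<Longrightarrow>
    finite_spectrum n \<Lambda> \<Longrightarrow> \<exists>n' \<Lambda>'. n < n' \<and> finite_spectrum n' \<Lambda>' \<and> \<Lambda> \<subseteq> \<Lambda>' \<and> dominated t (eps t) m n' \<Lambda>'"
    by metis
  txt \<open>Stage \<open>m\<close> serves the eigenvalue \<open>\<tau> m\<close>; each element of \<open>E\<close> is served infinitely often.\<close>
  define \<tau> where "\<tau> m = from_nat_into E (fst (prod_decode m))" for m
  have \<tau>_in: "\<tau> m \<in> E" for m
    using one_in_E by (auto simp: \<tau>_def intro!: from_nat_into)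
  have \<tau>_often: "\<exists>m\<ge>m0. \<tau> m = t" if t: "t \<in> E" for t m0
  proof -
    obtain i where "from_nat_into E i = t"
      using from_nat_into_surj[OF _ t] by auto
    then have "\<tau> (prod_encode (i, m0)) = t" by (simp add: \<tau>_def)
    then show ?thesis using le_prod_encode_2 by blast
  qed
  define succ where "succ m S S' \<longleftrightarrow> fst S < fst S' \<and> finite_spectrum (fst S') (snd S') \<and>
      snd S \<subseteq> snd S' \<and> dominated (\<tau> m) (eps (\<tau> m)) m (fst S') (snd S')" for m and S S' :: "nat \<times> real set"
  \<comment> \<open>Room is left for an intermediate \<open>\<Lambda>0\<close>, so that a split can
    precede the dominated extension.\<close>
  have succ_ex: "\<exists>S'. succ m (n, \<Lambda>) S' \<and> \<Lambda>0 \<subseteq> snd S'"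
    if ext0: "finite_spectrum n0 \<Lambda>0" "n \<le> n0" "\<Lambda> \<subseteq> \<Lambda>0" for m n n0 \<Lambda> \<Lambda>0
  proof -
    obtain n' \<Lambda>' where "n0 < n'" "finite_spectrum n' \<Lambda>'" "\<Lambda>0 \<subseteq> \<Lambda>'"
      "dominated (\<tau> m) (eps (\<tau> m)) m n' \<Lambda>'"
      using ext[OF \<tau>_in ext0(1), of m m] by blast
    with ext0 show ?thesis
      by (intro exI[of _ "(n', \<Lambda>')"]) (auto simp: succ_def)
  qed
  have step: "\<exists>S1 S2. succ m S S1 \<and> succ m S S2 \<and>
      ((\<exists>s\<in>E. 1 < s) \<longrightarrow> (\<forall>k \<Theta>. finite_spectrum k \<Theta> \<longrightarrow> \<not> snd S1 \<union> snd S2 \<subseteq> \<Theta>))"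
    if S: "finite_spectrum (fst S) (snd S)" for m S
  proof (cases "\<exists>s\<in>E. 1 < s")
    case True
    then obtain s where s: "s \<in> E" "1 < s" by auto
    obtain n' \<Lambda>1 \<Lambda>2 where n': "fst S < n'"
      and \<Lambda>12: "finite_spectrum n' \<Lambda>1" "finite_spectrum n' \<Lambda>2" "snd S \<subseteq> \<Lambda>1" "snd S \<subseteq> \<Lambda>2"
      and incompat: "\<And>m \<Theta>. finite_spectrum m \<Theta> \<Longrightarrow> \<not> \<Lambda>1 \<union> \<Lambda>2 \<subseteq> \<Theta>"
      using finite_spectrum_split[OF s S] by blast
    \<comment> \<open>Enlarging \<open>\<Lambda>1\<close> and \<open>\<Lambda>2\<close> keeps them
      incompatible.\<close>
    obtain S1 S2 where "succ m S S1" "\<Lambda>1 \<subseteq> snd S1" "succ m S S2" "\<Lambda>2 \<subseteq> snd S2"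
      using succ_ex[OF \<Lambda>12(1) _ \<Lambda>12(3), of "fst S" m] succ_ex[OF \<Lambda>12(2) _ \<Lambda>12(4), of "fst S" m] n'
      by auto
    then show ?thesis
      using incompat by (intro exI[of _ S1] exI[of _ S2]) blast
  next
    case False
    then show ?thesis
      using succ_ex[OF S order_refl order_refl, of m] by auto
  qed
  define Q where "Q m S p \<longleftrightarrow> succ m S (fst p) \<and> succ m S (snd p) \<and>
      ((\<exists>s\<in>E. 1 < s) \<longrightarrow> (\<forall>k \<Theta>. finite_spectrum k \<Theta> \<longrightarrow> \<not> snd (fst p) \<union> snd (snd p) \<subseteq> \<Theta>))"
    for m S p
  \<comment> \<open>The choice depends on stage and state only, so that sequences with a common
    prefix pass through the same states.\<close>
  define p where "p m S = (SOME p. Q m S p)" for m S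
  define nxt where "nxt m S b = (if b then fst (p m S) else snd (p m S))" for m S and b :: bool
  have Q: "Q m S (p m S)" if S: "finite_spectrum (fst S) (snd S)" for m S
    unfolding p_def
  proof (rule someI_ex)
    show "\<exists>p. Q m S p"
      using step[OF S, of m] unfolding Q_def split_paired_Ex fst_conv snd_conv .
  qed
  have nxt: "succ m S (nxt m S b)" if S: "finite_spectrum (fst S) (snd S)" for m S b
    using Q[OF S, of m] unfolding Q_def nxt_def by simp
  have nxt_inc: "\<not> snd (nxt m S True) \<union> snd (nxt m S False) \<subseteq> \<Theta>"
    if S: "finite_spectrum (fst S) (snd S)" and "\<exists>s\<in>E. 1 < s" "finite_spectrum k \<Theta>" for m S k \<Theta>
    using Q[OF S, of m] that(2,3) unfolding Q_def nxt_def if_True if_False by blast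
  define st where "st \<omega> = rec_nat (0, {0}) (\<lambda>m S. nxt m S (\<omega> m))" for \<omega> :: "nat \<Rightarrow> bool"
  have st_0: "st \<omega> 0 = (0, {0})" and st_Suc: "st \<omega> (Suc m) = nxt m (st \<omega> m) (\<omega> m)" for \<omega> m
    by (simp_all add: st_def)
  have spec: "finite_spectrum (fst (st \<omega> m)) (snd (st \<omega> m))" for \<omega> m
  proof (induction m)
    case (Suc m)
    from nxt[OF this] show ?case by (simp add: st_Suc succ_def)
  qed (simp add: st_0 finite_spectrum_0)
  have succ: "succ m (st \<omega> m) (st \<omega> (Suc m))" for \<omega> m
    using nxt[OF spec] by (simp add: st_Suc)
  have mono_n: "strict_mono (\<lambda>m. fst (st \<omega> m))" for \<omega>
    using succ by (intro strict_monoI_Suc) (simp add: succ_def)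
  have inc: "incseq (\<lambda>m. snd (st \<omega> m))" for \<omega>
    using succ by (intro incseq_SucI) (simp add: succ_def)
  define \<Lambda> where "\<Lambda> \<omega> = (\<Union>m. snd (st \<omega> m))" for \<omega>
  have "\<Lambda> \<omega> \<subseteq> \<int>" for \<omega>
    using spec unfolding \<Lambda>_def finite_spectrum_def by blast
  moreover have "is_spectrum \<mu> ((*) (real t) ` \<Lambda> \<omega>)" if t: "t \<in> E" for t \<omega>
    unfolding \<Lambda>_def
  proof (rule is_spectrum_Union[OF spec mono_n inc t eps[OF t]])
    fix m0
    \<comment> \<open>Stage \<open>m\<close> produces the state with index \<open>Suc m\<close>, and
      its window of radius \<open>m\<close> contains the one of radius \<open>m0\<close>.\<close>
    obtain m where m: "m0 \<le> m" "\<tau> m = t" using \<tau>_often[OF t] by blast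
    have "dominated t (eps t) m (fst (st \<omega> (Suc m))) (snd (st \<omega> (Suc m)))"
      using succ[of m \<omega>] m(2) by (simp add: succ_def)
    then show "\<exists>m\<ge>m0. dominated t (eps t) m0 (fst (st \<omega> m)) (snd (st \<omega> m))"
      unfolding dominated_def using m(1) by (intro exI[of _ "Suc m"]) fastforce
  qed
  moreover have "inj \<Lambda>" if "\<exists>s\<in>E. 1 < s"
  proof (rule injI)
    fix \<omega> \<omega>' assume eq: "\<Lambda> \<omega> = \<Lambda> \<omega>'"
    show "\<omega> = \<omega>'"
    proof (rule ccontr)
      assume "\<omega> \<noteq> \<omega>'"
      then have ex: "\<exists>m. \<omega> m \<noteq> \<omega>' m" by auto
      \<comment> \<open>At the first disagreement both sequences are in the same state and take the
        two incompatible successors.\<close>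
      define m where "m = (LEAST m. \<omega> m \<noteq> \<omega>' m)"
      have m: "\<omega> m \<noteq> \<omega>' m" "\<And>i. i < m \<Longrightarrow> \<omega> i = \<omega>' i"
        using LeastI_ex[OF ex] not_less_Least[of _ "\<lambda>m. \<omega> m \<noteq> \<omega>' m"] unfolding m_def by blast+
      have "st \<omega> i = st \<omega>' i" if "i \<le> m" for i
        using that by (induction i) (auto simp: st_0 st_Suc m(2))
      then have same: "st \<omega>' m = st \<omega> m" by simp
      \<comment> \<open>If the unions coincide, this finite set lies in a single level, against
        incompatibility.\<close>
      define A where "A = snd (st \<omega> (Suc m)) \<union> snd (st \<omega>' (Suc m))"
      have A: "A = snd (nxt m (st \<omega> m) True) \<union> snd (nxt m (st \<omega> m) False)"
        unfolding A_def st_Suc same using m(1) by (cases "\<omega> m") auto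
      have "snd (st \<omega> (Suc m)) \<subseteq> \<Lambda> \<omega>" "snd (st \<omega>' (Suc m)) \<subseteq> \<Lambda> \<omega>'"
        unfolding \<Lambda>_def by auto
      then have "A \<subseteq> \<Lambda> \<omega>" unfolding A_def using eq by auto
      moreover have "finite A"
        using spec unfolding A_def finite_spectrum_def by simp
      ultimately obtain i where "A \<subseteq> snd (st \<omega> i)"
        unfolding \<Lambda>_def using finite_subset_incseq_Union[OF inc] by blast
      then show False
        using nxt_inc[OF spec that spec] unfolding A by blast
    qed
  qed
  ultimately show ?thesis using that by blast
qed

end

section \<open>Reduction to 1 being an eigenvalue, and conclusion\<close>

text \<open>The shift by \<open>t * k\<close> is itself a shift by an integer, and the unit interval
  lies in the one for \<open>t\<close>; the same tails and constants serve.\<close>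

lemma equi_positive_convolution_1:
  assumes "equi_positive_convolution t N B \<mu>" "0 < t"
  shows "equi_positive_convolution 1 N B \<mu>"
proof -
  obtain \<sigma> :: "nat \<Rightarrow> nat" and \<nu> \<epsilon> \<delta> where \<sigma>: "strict_mono \<sigma>"
    and \<nu>: "\<And>j. is_tail_convolution N B (\<sigma> j) (\<nu> j)" and pos: "0 < \<epsilon>" "0 < \<delta>"
    and ep: "\<And>x j. x \<in> {0..<real t} \<Longrightarrow> \<exists>k::int. (x = 0 \<longrightarrow> k = 0) \<and>
      (\<forall>y. \<bar>y\<bar> < \<delta> \<longrightarrow> \<epsilon> \<le> norm (fourier_transform (\<nu> j) (x + y + real t * real_of_int k)))"
    by (rule equi_positive_convolutionE[OF assms(1)]) (rule that)
  have "\<exists>k::int. (x = 0 \<longrightarrow> k = 0) \<and>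
      (\<forall>y. \<bar>y\<bar> < \<delta> \<longrightarrow> \<epsilon> \<le> norm (fourier_transform (\<nu> j) (x + y + real 1 * real_of_int k)))"
    if "x \<in> {0..<real 1}" for x j
  proof -
    have "x \<in> {0..<real t}" using that \<open>0 < t\<close> by auto
    then obtain k :: int where "(x = 0 \<longrightarrow> k = 0) \<and>
      (\<forall>y. \<bar>y\<bar> < \<delta> \<longrightarrow> \<epsilon> \<le> norm (fourier_transform (\<nu> j) (x + y + real t * real_of_int k)))"
      using ep by blast
    then show ?thesis
      by (intro exI[of _ "int t * k"]) simp
  qed
  then have "equi_positive_family 1 (range \<nu>)"
    using pos \<nu> unfolding equi_positive_family_def is_tail_convolution_def is_infinite_convolution_def
    by (intro conjI exI[of _ \<epsilon>] exI[of _ \<delta>]) auto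
  then show ?thesis
    using assms(1) \<sigma> \<nu> unfolding equi_positive_convolution_def by blast
qed

lemma uncountable_nat_bool: "uncountable (UNIV :: (nat \<Rightarrow> bool) set)"
proof
  assume "countable (UNIV :: (nat \<Rightarrow> bool) set)"
  then obtain f :: "nat \<Rightarrow> nat \<Rightarrow> bool" where "range f = UNIV"
    using uncountable_def by blast
  \<comment> \<open>Cantor's diagonal sequence.\<close>
  then obtain n where "f n = (\<lambda>m. \<not> f m m)"
    by (metis rangeE UNIV_I)
  then have "f n n = (\<not> f n n)" by (rule fun_cong)
  then show False by simp
qed

theorem theorem1p2:
  fixes N :: "nat \<Rightarrow> nat" and B :: "nat \<Rightarrow> real set" and \<mu> :: "real measure" and E :: "nat set"
  assumes "\<And>k. admissible_pair (N k) (B k)"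
    and "is_infinite_convolution N B \<mu>"
    and "E = {t. 0 < t \<and> (\<forall>k. admissible_eigenvalue (N k) (B k) (real t)) \<and>
                 equi_positive_convolution t N B \<mu>}"
  shows "(E \<noteq> {} \<longrightarrow> spectral_measure \<mu>) \<and>
    ((\<exists>t\<in>E. 1 < t) \<longrightarrow>
       uncountable {\<Lambda>. \<Lambda> \<subseteq> \<int> \<and> (\<forall>t\<in>E. is_spectrum \<mu> ((*) (real t) ` \<Lambda>))} \<and>
       (\<forall>t\<in>E. spectral_eigenvalue \<mu> (real t)))"
proof (cases "E = {}")
  case False
  \<comment> \<open>Multiplication by 1 fixes \<open>L\<close>, so 1 is always an admissible
    eigenvalue; equi-positivity passes from any \<open>t\<close> to 1.\<close>
  then have "1 \<in> E"
    using assms(1) equi_positive_convolution_1 unfolding assms(3)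
    by (auto simp: admissible_eigenvalue_def)
  then interpret admissible_sequence N B E \<mu>
    by unfold_locales (use assms in auto)
  obtain \<Lambda> :: "(nat \<Rightarrow> bool) \<Rightarrow> real set" where \<Lambda>: "\<And>\<omega>. \<Lambda> \<omega> \<subseteq> \<int>"
    and spectrum: "\<And>\<omega> t. t \<in> E \<Longrightarrow> is_spectrum \<mu> ((*) (real t) ` \<Lambda> \<omega>)"
    and inj: "\<exists>s\<in>E. 1 < s \<Longrightarrow> inj \<Lambda>"
    using spectra_family by blast
  have spectrum1: "is_spectrum \<mu> (\<Lambda> \<omega>)" for \<omega>
    using spectrum[OF one_in_E] by simp
  have "spectral_eigenvalue \<mu> (real t)" if "t \<in> E" for t
    using spectrum1 spectrum[OF that] E_pos[OF that] unfolding spectral_eigenvalue_def by auto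
  moreover have "uncountable {\<Lambda>. \<Lambda> \<subseteq> \<int> \<and> (\<forall>t\<in>E. is_spectrum \<mu> ((*) (real t) ` \<Lambda>))}"
    if "\<exists>t\<in>E. 1 < t"
  proof
    assume "countable {\<Lambda>. \<Lambda> \<subseteq> \<int> \<and> (\<forall>t\<in>E. is_spectrum \<mu> ((*) (real t) ` \<Lambda>))}"
    then have "countable (range \<Lambda>)"
      by (rule countable_subset[rotated]) (use \<Lambda> spectrum in auto)
    then have "countable (UNIV :: (nat \<Rightarrow> bool) set)"
      using inj[OF that] by (rule countable_image_inj_on)
    then show False
      using uncountable_nat_bool by blast
  qed
  moreover have "spectral_measure \<mu>"
    using spectrum1 unfolding spectral_measure_def by blast
  ultimately show ?thesis
    by blast
qed simp

end
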